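(* Let $q$ be a power of a prime $p$, let $A=\mathbb{F}_q[t]$, and let $v$ be a prime (monic irreducible polynomial) of $\mathbb{F}_q[t]$ of degree one. Let $m$ be a positive integer, let $z\in\mathbb{Z}/(q-1)\mathbb{Z}$, put $y=(z,m)$, and let $r$ be the least non-negative residue of $z$ modulo $q-1$. Let $d\geq 1$ be an integer. Consider decompositions $m=m_0\oplus m_1\oplus\cdots\oplus m_d$ (non-negative integers summing to $m$ with no carry in base $p$) such that $(q-1)\mid m_i$ and $m_i>0$ for all $0<i<d$, and $(q-1)\mid z-m_d$. If no such decomposition exists, then $v_d(y)=\infty$. Otherwise $$v_d(y)=\min\,(m_1+2m_2+\cdots+d\,m_d),$$ the minimum taken over all such decompositions; moreover the minimizing decomposition is unique and is given by the greedy algorithm: $m_d$ is the least possible sum of $p$-powers chosen from the base-$p$ expansion of $m$ (i.e. $m$ written as a sum of powers of $p$, each power $p^e$ appearing as many times as the base-$p$ digit of $m$ at $p^e$) which is congruent to $r$ modulo $q-1$.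
   Context: For a monic $a\in\mathbb{F}_q[t]$ of degree $d$ coprime to $v$, and $y=(z,m)$, the power $a^y$ is defined as follows: write $\omega(a)\in\mathbb{F}_q^*$ for the unique element with $a\equiv \omega(a)\pmod v$; then $a/\omega(a)$ is a one-unit at $v$ and $a^y:=\omega(a)^z\,(a/\omega(a))^m$ (here $\omega(a)^z$ is well defined since $\omega(a)^{q-1}=1$). For instance, for $v=t$ and $a=f_0+f_1t+\cdots+f_{d-1}t^{d-1}+t^d$ with $f_0\neq 0$, $a^y=f_0^z(a/f_0)^m$. Define $$S_{d,v}(y)=\sum_{\substack{a\in\mathbb{F}_q[t]\text{ monic}\\ \deg a=d,\ (v,a)=1}} a^y,\qquad v_d(y)=\mathrm{val}_v(S_{d,v}(y)),$$ where $\mathrm{val}_v$ is the $v$-adic valuation (with $\mathrm{val}_v(0)=\infty$). The notation $m=m_0\oplus\cdots\oplus m_d$ means $m=m_0+\cdots+m_d$ with $m_i\ge 0$ and no carry over of digits when the sum is performed in base $p$.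
   Formalization: The last clause (m_d is the least sum of p-powers from m congruent to r) fails for q=4, d=2, r=2, m=109; it is stated only for q prime, d=1 or r=0. For all q, greedy instead means the tail sums m_i+...+m_d, i=1,...,d, are successively least among choices extending to a decomposition. *)

theory Defs
  imports
    "HOL-Number_Theory.Cong"
    "HOL-Computational_Algebra.Computational_Algebra"
    "HOL-Library.Extended_Nat"
begin

section \<open>The \<open>v\<close>-adic power sums\<close>

definition omega :: "'a :: {finite, field} poly \<Rightarrow> 'a poly \<Rightarrow> 'a" where
  "omega v a = (THE c. c \<noteq> 0 \<and> [a = [:c:]] (mod v))"

text \<open>The exponent is \<open>y = (z, m)\<close>, where the integer \<open>z\<close> represents a class modulo \<open>q - 1\<close>.
  Since \<open>m\<close> is a natural number, \<open>a\<^sup>y\<close> is again a polynomial.\<close>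

definition vpow :: "'a :: {finite, field} poly \<Rightarrow> 'a poly \<Rightarrow> int \<Rightarrow> nat \<Rightarrow> 'a poly" where
  "vpow v a z m = smult (omega v a powi z) (smult (inverse (omega v a)) a ^ m)"

definition monics :: "nat \<Rightarrow> 'a :: {finite, field} poly \<Rightarrow> 'a poly set" where
  "monics d v = {a. lead_coeff a = 1 \<and> degree a = d \<and> coprime v a}"

definition power_sum :: "nat \<Rightarrow> 'a :: {finite, field} poly \<Rightarrow> int \<Rightarrow> nat \<Rightarrow> 'a poly" where
  "power_sum d v z m = (\<Sum>a\<in>monics d v. vpow v a z m)"

text \<open>The library constant \<open>multiplicity\<close> is not available here, because it requires the
  coefficient field to be an instance of the class \<open>field_gcd\<close>.\<close>

definition val :: "'a :: {finite, field} poly \<Rightarrow> 'a poly \<Rightarrow> enat" where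
  "val v f = (if f = 0 then \<infinity> else enat (Max {n. v ^ n dvd f}))"

lemma finite_monics: "finite (monics d (v :: 'a :: {finite, field} poly))"
proof (rule finite_subset)
  show "monics d v \<subseteq> Poly ` {xs. set xs \<subseteq> UNIV \<and> length xs \<le> Suc d}"
  proof
    fix a assume "a \<in> monics d v"
    then have "length (coeffs a) \<le> Suc d"
      by (cases "a = 0") (auto simp: monics_def length_coeffs_degree)
    then show "a \<in> Poly ` {xs. set xs \<subseteq> UNIV \<and> length xs \<le> Suc d}"
      by (intro image_eqI[of _ _ "coeffs a"]) auto
  qed
qed (intro finite_imageI finite_lists_length_le, simp)

lemma omega_unique_existence:
  fixes v a :: "'a :: {finite, field} poly"
  assumes "degree v = 1" "coprime v a"
  shows "\<exists>!c. c \<noteq> 0 \<and> [a = [:c:]] (mod v)"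
proof -
  have v0: "v \<noteq> 0" "\<not> is_unit v"
    using assms(1) is_unit_iff_degree[of v] by (cases "v = 0"; simp)+
  have "degree (a mod v) = 0"
    using degree_mod_less[OF v0(1), of a] assms(1) by auto
  then obtain c where c: "a mod v = [:c:]" by (rule degree_eq_zeroE)
  have cong: "[a = [:e:]] (mod v) \<longleftrightarrow> e = c" for e
  proof -
    have "[:e:] mod v = [:e:]" using assms(1) by (intro mod_poly_less) auto
    then show ?thesis using c by (auto simp: cong_def)
  qed
  have "c \<noteq> 0"
    using c v0 assms(2) by (auto simp: mod_eq_0_iff_dvd dest: coprime_absorb_left)
  then show ?thesis using cong by auto
qed


section \<open>Carry-free decompositions\<close>

definition digit :: "nat \<Rightarrow> nat \<Rightarrow> nat \<Rightarrow> nat" where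
  "digit p n e = n div p ^ e mod p"

text \<open>A decomposition \<open>m\<^sub>0, \<dots>, m\<^sub>d\<close> is a list \<open>ms\<close> of length \<open>d + 1\<close>. There is no carry iff the
  digits in each position add up to less than \<open>p\<close>.\<close>

definition no_carry :: "nat \<Rightarrow> nat list \<Rightarrow> bool" where
  "no_carry p ms \<longleftrightarrow> (\<forall>e. (\<Sum>k\<leftarrow>ms. digit p k e) < p)"

definition decomps :: "nat \<Rightarrow> nat \<Rightarrow> int \<Rightarrow> nat \<Rightarrow> nat \<Rightarrow> nat list set" where
  "decomps p q z m d = {ms. length ms = d + 1 \<and> sum_list ms = m \<and> no_carry p ms \<and>
     (\<forall>i. 0 < i \<and> i < d \<longrightarrow> (q - 1) dvd ms ! i \<and> ms ! i > 0) \<and>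
     int (q - 1) dvd z - int (ms ! d)}"

definition weight :: "nat list \<Rightarrow> nat" where
  "weight ms = (\<Sum>i<length ms. i * ms ! i)"

lemma finite_decomps: "finite (decomps p q z m d)"
proof (rule finite_subset)
  show "decomps p q z m d \<subseteq> {ms. set ms \<subseteq> {..m} \<and> length ms = d + 1}"
    by (auto simp: decomps_def member_le_sum_list)
qed (intro finite_lists_length_eq, simp)


section \<open>Greedy choices\<close>

definition p_powers :: "nat \<Rightarrow> nat \<Rightarrow> nat multiset" where
  "p_powers p n = (\<Sum>e\<le>n. replicate_mset (digit p n e) (p ^ e))"

definition p_power_sums :: "nat \<Rightarrow> nat \<Rightarrow> nat set" where
  "p_power_sums p n = {\<Sum>\<^sub># N | N. N \<subseteq># p_powers p n}"

definition tail_sum :: "nat list \<Rightarrow> nat \<Rightarrow> nat" where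
  "tail_sum ms i = sum_list (drop i ms)"

text \<open>Write \<open>n\<^sub>i = m\<^sub>i + \<dots> + m\<^sub>d\<close>, so that \<open>n\<^sub>0 = m\<close> and \<open>n\<^sub>d = m\<^sub>d\<close>, the sum \<open>m\<^sub>1 + 2 m\<^sub>2 + \<dots> + d m\<^sub>d\<close>
  equals \<open>n\<^sub>1 + \<dots> + n\<^sub>d\<close>, and every \<open>n\<^sub>i\<close> with \<open>i \<ge> 1\<close> is congruent to \<open>r\<close>. The greedy algorithm
  chooses \<open>n\<^sub>1, n\<^sub>2, \<dots>, n\<^sub>d\<close> in this order, each \<open>n\<^sub>i\<close> being the least possible sum of \<open>p\<close>-powers
  from the expansion of \<open>n\<^bsub>i-1\<^esub>\<close> that is congruent to \<open>r\<close>. Here ``possible'' means that the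
  choices made so far extend to a decomposition. For prime \<open>q\<close>, for \<open>d = 1\<close> and for
  \<open>r = 0\<close>, the resulting \<open>n\<^sub>d\<close> is also the least sum of \<open>p\<close>-powers from the expansion of \<open>m\<close> itself
  that is congruent to \<open>r\<close>. For \<open>q = 4\<close>, \<open>d = 2\<close>, \<open>r = 2\<close>, \<open>m = 109 = 1 + 4 + 8 + 32 + 64\<close>
  it is not: the minimum is attained only by \<open>(68, 33, 8)\<close>, although \<open>5 = 1 + 4\<close> is
  congruent to \<open>2\<close> and \<open>(32, 72, 5)\<close> is a decomposition.\<close>

definition greedy :: "nat \<Rightarrow> nat \<Rightarrow> int \<Rightarrow> nat \<Rightarrow> nat \<Rightarrow> nat \<Rightarrow> nat list \<Rightarrow> bool" where
  "greedy p q z r m d ms \<longleftrightarrow> ms \<in> decomps p q z m d \<and>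
     (\<forall>i\<in>{1..d}. tail_sum ms i =
        (LEAST n. n \<in> p_power_sums p (tail_sum ms (i - 1)) \<and> [n = r] (mod (q - 1)) \<and>
           (\<exists>ns \<in> decomps p q z m d. (\<forall>j<i. tail_sum ns j = tail_sum ms j) \<and> tail_sum ns i = n)))"

end

theory Submission
  imports Defs
begin

text \<open>
  Write \<open>q = p\<^sup>k\<close> and \<open>v = t - \<theta>\<close>. Expanding monic polynomials in powers of \<open>v\<close> shows that the power sum
  is a combination, with nonzero coefficients, of the \<open>v\<close>-powers with exponents \<open>n\<^sub>1 + \<dots> + n\<^sub>d\<close>, one for
  each chain \<open>m, n\<^sub>1, \<dots>, n\<^sub>d\<close> in which every \<open>n\<^sub>i\<close> is digitwise bounded by its predecessor, is
  congruent to \<open>r\<close>, and differs from its predecessor if \<open>i > 1\<close>. It remains to see that a chain of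
  least sum has the least possible \<open>n\<^sub>1\<close>; uniqueness and the greedy description follow by
  induction along the chain.

  Regard a digit at position \<open>e\<close> as that many coins of value \<open>p\<^sup>e\<close> and of class \<open>e mod k\<close>. A submask
  of \<open>m\<close> is congruent to \<open>r\<close> iff its vector of class counts equals \<open>r e\<^sub>0 + (p x\<^sub>l - x\<^bsub>l-1\<^esub>)\<^sub>l\<close> (cyclic indices)
  for some integer vector \<open>x\<close>. The cost of \<open>x\<close>, which takes the cheapest coins in each class, is a
  submodular function of \<open>x\<close>, because it is a sum of convex functions of the \<open>p x\<^sub>l - x\<^bsub>l-1\<^esub>\<close>. Relaxing
  the chain condition to \<open>x\<^bsub>i+1\<^esub> < x\<^sub>i\<close> in every coordinate makes the chains closed under meet and
  join, and an optimal relaxed chain is a genuine one. If the first member of an optimal chain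
  had more than the least possible cost, pushing the whole chain down would save the largest coin
  in which the two differ at the price of using each smaller coin at most once more. As \<open>m\<close> has at
  most \<open>p - 1\<close> coins of each value, the smaller coins together are worth less.
\<close>

section \<open>Optimal chains of coin vectors\<close>

locale coin_system =
  fixes I :: "nat set" and pr :: "nat \<Rightarrow> nat" and p :: int
    and V :: "nat \<Rightarrow> int" and w :: "nat \<Rightarrow> nat \<Rightarrow> int" and v0 :: "nat \<Rightarrow> int"
  assumes finI: "finite I" and I_ne: "I \<noteq> {}"
    and pr_in: "l \<in> I \<Longrightarrow> pr l \<in> I"
    and pr_conn: "S \<subseteq> I \<Longrightarrow> S \<noteq> {} \<Longrightarrow> (\<And>l. l \<in> S \<Longrightarrow> pr l \<in> S) \<Longrightarrow> S = I"
    and p2: "p \<ge> 2"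
    and w_nonneg: "0 \<le> w l s"
    and w_mono: "l \<in> I \<Longrightarrow> s \<le> s' \<Longrightarrow> int s' < V l \<Longrightarrow> w l s \<le> w l s'"
    and w_gap: "l \<in> I \<Longrightarrow> int s + p - 1 \<le> int s' \<Longrightarrow> int s' < V l \<Longrightarrow> w l s < w l s'"
    and w_super: "l \<in> I \<Longrightarrow> int s < V l \<Longrightarrow>
       (\<Sum>l'\<in>I. \<Sum>s' | int s' < V l' \<and> w l' s' < w l s. w l' s') < w l s"
    and w_class: "l \<in> I \<Longrightarrow> l' \<in> I \<Longrightarrow> int s < V l \<Longrightarrow> int s' < V l' \<Longrightarrow> w l s = w l' s' \<Longrightarrow> l = l'"
begin

lemma pr_inj: "inj_on pr I"
proof -
  have "pr ` I = I"
    by (rule pr_conn) (use pr_in I_ne in auto)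
  then show ?thesis using finI by (simp add: eq_card_imp_inj_on)
qed

text \<open>The matrix \<open>p \<cdot> 1 - P\<close>, with \<open>P\<close> the permutation matrix of \<open>pr\<close>, has a positive inverse.\<close>

lemma cyclic_nonneg:
  assumes "\<And>l. l \<in> I \<Longrightarrow> 0 \<le> p * D l - D (pr l)" and "l \<in> I"
  shows "0 \<le> D l"
proof -
  obtain l0 where l0: "l0 \<in> I" "\<And>l. l \<in> I \<Longrightarrow> D l0 \<le> D l"
  proof -
    have "Min (D ` I) \<in> D ` I" using finI I_ne by (intro Min_in) auto
    then obtain k where "k \<in> I" "D k = Min (D ` I)" by force
    then show thesis using finI by (intro that[of k]) auto
  qed
  have "D l0 \<le> D (pr l0)" using l0 pr_in by auto
  then have "D l0 \<le> p * D l0" using assms(1)[OF l0(1)] by simp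
  then have "0 \<le> (p - 1) * D l0" by (simp add: algebra_simps)
  then have "0 \<le> D l0" using p2 by (simp add: zero_le_mult_iff)
  then show ?thesis using l0(2)[OF assms(2)] by simp
qed

lemma cyclic_pos:
  assumes nn: "\<And>l. l \<in> I \<Longrightarrow> 0 \<le> p * D l - D (pr l)" and "l0 \<in> I" "D l0 \<noteq> 0" and "l \<in> I"
  shows "1 \<le> D l"
proof (rule ccontr)
  assume "\<not> 1 \<le> D l"
  let ?S = "{l \<in> I. D l = 0}"
  have "D l = 0" using cyclic_nonneg[of D, OF nn \<open>l \<in> I\<close>] \<open>\<not> 1 \<le> D l\<close> by simp
  then have "?S = I"
  proof (intro pr_conn)
    fix k assume k: "k \<in> ?S"
    then have "D (pr k) \<le> 0" using nn[of k] by simp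
    moreover have "0 \<le> D (pr k)" using k pr_in by (intro cyclic_nonneg[of D, OF nn]) auto
    ultimately show "pr k \<in> ?S" using k pr_in by auto
  qed (use \<open>l \<in> I\<close> in auto)
  then show False using assms by auto
qed

lemma cyclic_eq:
  assumes "\<And>l. l \<in> I \<Longrightarrow> p * x l - x (pr l) = p * y l - y (pr l)" and "l \<in> I"
  shows "x l = y l"
proof -
  have "0 \<le> (\<lambda>l. x l - y l) l"
    by (rule cyclic_nonneg) (use assms in \<open>auto simp: algebra_simps\<close>)
  moreover have "0 \<le> (\<lambda>l. y l - x l) l"
    by (rule cyclic_nonneg) (use assms in \<open>auto simp: algebra_simps\<close>)
  ultimately show ?thesis by simp
qed

definition below :: "(nat \<Rightarrow> int) \<Rightarrow> (nat \<Rightarrow> int) \<Rightarrow> bool" where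
  "below x y \<longleftrightarrow> (\<forall>l\<in>I. x l \<le> y l)"

definition slack :: "(nat \<Rightarrow> int) \<Rightarrow> (nat \<Rightarrow> int) \<Rightarrow> nat \<Rightarrow> int" where
  "slack u x l = u l + p * x l - x (pr l)"

definition nonneg :: "(nat \<Rightarrow> int) \<Rightarrow> (nat \<Rightarrow> int) \<Rightarrow> bool" where
  "nonneg u x \<longleftrightarrow> (\<forall>l\<in>I. 0 \<le> slack u x l)"

definition top_below :: "(nat \<Rightarrow> int) \<Rightarrow> (nat \<Rightarrow> int) \<Rightarrow> (nat \<Rightarrow> int) \<Rightarrow> bool" where
  "top_below u s x \<longleftrightarrow> below x s \<and> nonneg u x \<and> (\<forall>y. below y s \<and> nonneg u y \<longrightarrow> below y x) \<and>
     (\<forall>l\<in>I. x (pr l) = s (pr l) \<or> slack u x l = 0)"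

abbreviation meet :: "(nat \<Rightarrow> int) \<Rightarrow> (nat \<Rightarrow> int) \<Rightarrow> nat \<Rightarrow> int" where
  "meet x y \<equiv> \<lambda>l. min (x l) (y l)"

abbreviation join :: "(nat \<Rightarrow> int) \<Rightarrow> (nat \<Rightarrow> int) \<Rightarrow> nat \<Rightarrow> int" where
  "join x y \<equiv> \<lambda>l. max (x l) (y l)"

lemma slack_meet_join:
  assumes "l \<in> I"
  shows "slack u (meet x y) l + slack u (join x y) l = slack u x l + slack u y l"
    and "min (slack u x l) (slack u y l) \<le> slack u (meet x y) l"
    and "slack u (meet x y) l \<le> max (slack u x l) (slack u y l)"
    and "min (slack u x l) (slack u y l) \<le> slack u (join x y) l"
    and "slack u (join x y) l \<le> max (slack u x l) (slack u y l)"
proof -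
  have m: "p * a \<le> p * b" if "a \<le> b" for a b using that p2 by simp
  show "slack u (meet x y) l + slack u (join x y) l = slack u x l + slack u y l"
    by (auto simp: slack_def min_def max_def)
  show "min (slack u x l) (slack u y l) \<le> slack u (meet x y) l"
    using m[of "x l" "y l"] m[of "y l" "x l"] by (auto simp: slack_def min_def)
  show "slack u (meet x y) l \<le> max (slack u x l) (slack u y l)"
    using m[of "x l" "y l"] m[of "y l" "x l"] by (auto simp: slack_def min_def max_def)
  show "min (slack u x l) (slack u y l) \<le> slack u (join x y) l"
    using m[of "x l" "y l"] m[of "y l" "x l"] by (auto simp: slack_def min_def max_def)
  show "slack u (join x y) l \<le> max (slack u x l) (slack u y l)"
    using m[of "x l" "y l"] m[of "y l" "x l"] by (auto simp: slack_def max_def)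
qed

lemma nonneg_join: "nonneg u x \<Longrightarrow> nonneg u y \<Longrightarrow> nonneg u (join x y)"
  unfolding nonneg_def using slack_meet_join(4)[of _ u x y] by (smt (verit))

lemma top_below_exists:
  assumes "below b s" "nonneg u b"
  shows "\<exists>x. top_below u s x"
proof -
  define Q where "Q x \<longleftrightarrow> below x s \<and> nonneg u x" for x
  define f where "f x = nat (sum s I - sum x I)" for x
  obtain x where x: "Q x" and xmin: "\<And>y. Q y \<Longrightarrow> f x \<le> f y"
    using ex_has_least_nat[of Q b f] assms by (auto simp: Q_def)
  have big: "sum y I \<le> sum x I" if "Q y" for y
  proof -
    have "sum y I \<le> sum s I" using that by (auto simp: Q_def below_def intro: sum_mono)
    then show ?thesis using xmin[OF that] by (auto simp: f_def)
  qed
  have great: "below y x" if "Q y" for y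
  proof (rule ccontr)
    assume "\<not> below y x"
    then obtain l where l: "l \<in> I" "x l < y l" by (auto simp: below_def)
    have "Q (join y x)"
      using that x nonneg_join by (auto simp: Q_def below_def)
    then have "sum (join y x) I \<le> sum x I" by (rule big)
    moreover have "sum x I < sum (join y x) I"
      by (rule sum_strict_mono_ex1) (use finI l in \<open>auto intro!: bexI[of _ l]\<close>)
    ultimately show False by simp
  qed
  have "x (pr l) = s (pr l) \<or> slack u x l = 0" if l: "l \<in> I" for l
  proof (rule ccontr)
    assume neg: "\<not> ?thesis"
    then have 1: "x (pr l) < s (pr l)" "0 < slack u x l"
      using x l pr_in[OF l] by (auto simp: Q_def below_def nonneg_def le_less)
    define y where "y = x(pr l := x (pr l) + 1)"
    have "0 \<le> slack u y k" if k: "k \<in> I" for k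
    proof (cases "k = l")
      case True
      then show ?thesis using 1 p2 by (auto simp: slack_def y_def algebra_simps)
    next
      case False
      then have "pr k \<noteq> pr l" using pr_inj k l by (auto dest: inj_onD)
      then have "slack u x k \<le> slack u y k" using p2 by (auto simp: slack_def y_def algebra_simps)
      then show ?thesis using x k by (auto simp: Q_def nonneg_def intro: order_trans)
    qed
    then have "Q y" using x 1 by (auto simp: Q_def below_def nonneg_def y_def)
    then have "below y x" by (rule great)
    then show False using pr_in[OF l] by (auto simp: below_def y_def)
  qed
  then show ?thesis using x great by (auto simp: top_below_def Q_def intro!: exI[of _ x])
qed

lemma top_below_slack:
  assumes "top_below u s x" "l \<in> I"
  shows "slack u x l \<le> max 0 (slack u s l)"
proof -
  have "p * x l \<le> p * s l" using assms p2 by (auto simp: top_below_def below_def)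
  then show ?thesis using assms by (auto simp: top_below_def slack_def)
qed

definition phi :: "nat \<Rightarrow> int \<Rightarrow> int" where
  "phi l a = (\<Sum>s<nat a. w l s)"

lemma phi_diff_eq:
  assumes "0 \<le> a" "a \<le> b"
  shows "phi l b - phi l a = (\<Sum>s | a \<le> int s \<and> int s < b. w l s)"
proof -
  define A where "A = {s. a \<le> int s \<and> int s < b}"
  have e: "{..<nat b} = {..<nat a} \<union> A" using assms by (auto simp: A_def)
  have "finite A" unfolding A_def by (rule finite_subset[of _ "{..<nat b}"]) auto
  moreover have "{..<nat a} \<inter> A = {}" using assms by (auto simp: A_def)
  ultimately have "sum (w l) {..<nat b} = sum (w l) {..<nat a} + sum (w l) A"
    unfolding e by (simp add: sum.union_disjoint)
  then show ?thesis by (simp add: phi_def A_def)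
qed

lemma phi_mono: "0 \<le> a \<Longrightarrow> a \<le> b \<Longrightarrow> phi l a \<le> phi l b"
  by (auto simp: phi_def intro!: sum_mono2 w_nonneg)

lemma phi_diff_le:
  assumes "0 \<le> a" "finite A" "\<And>s. a \<le> int s \<Longrightarrow> int s < b \<Longrightarrow> s \<in> A"
  shows "phi l b - phi l a \<le> sum (w l) A"
proof (cases "a \<le> b")
  case True
  show ?thesis unfolding phi_diff_eq[OF assms(1) True]
    by (rule sum_mono2) (use assms w_nonneg in auto)
next
  case False
  have "phi l b \<le> phi l a" using False by (auto simp: phi_def intro!: sum_mono2 w_nonneg)
  then show ?thesis using sum_nonneg[of A "w l"] w_nonneg by fastforce
qed

lemma phi_convex:
  assumes l: "l \<in> I" and sum: "a' + b' = a + b" and lo: "min a b \<le> a'" and hi: "a' \<le> max a b"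
    and r: "0 \<le> a" "0 \<le> b" "a \<le> V l" "b \<le> V l"
  shows "phi l a' + phi l b' \<le> phi l a + phi l b"
proof -
  have *: "phi l a' + phi l b' \<le> phi l a + phi l b"
    if "a' + b' = a + b" "a \<le> a'" "a' \<le> b" "0 \<le> a" "b \<le> V l" for a b a' b' :: int
  proof -
    define n where "n = nat (a' - a)"
    have e1: "phi l a' - phi l a = (\<Sum>i<n. w l (nat a + i))"
      unfolding phi_diff_eq[OF that(4,2)]
      by (rule sum.reindex_bij_witness[of _ "\<lambda>i. nat a + i" "\<lambda>s. s - nat a"])
        (use that(2-4) in \<open>auto simp: n_def\<close>)
    have e2: "phi l b - phi l b' = (\<Sum>i<n. w l (nat b' + i))"
    proof -
      have "0 \<le> b'" "b' \<le> b" "n = nat (b - b')" using that n_def by linarith+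
      show ?thesis unfolding phi_diff_eq[OF \<open>0 \<le> b'\<close> \<open>b' \<le> b\<close>]
        by (rule sum.reindex_bij_witness[of _ "\<lambda>i. nat b' + i" "\<lambda>s. s - nat b'"])
          (use \<open>0 \<le> b'\<close> \<open>b' \<le> b\<close> \<open>n = nat (b - b')\<close> in auto)
    qed
    have "(\<Sum>i<n. w l (nat a + i)) \<le> (\<Sum>i<n. w l (nat b' + i))"
    proof (rule sum_mono)
      fix i assume "i \<in> {..<n}"
      then show "w l (nat a + i) \<le> w l (nat b' + i)"
        by (intro w_mono[OF l]) (use that n_def in auto)
    qed
    then show ?thesis using e1 e2 by simp
  qed
  show ?thesis
  proof (cases "a \<le> b")
    case True
    then show ?thesis using *[OF sum] lo hi r by simp
  next
    case False
    then show ?thesis using *[of a' b' b a] sum lo hi r by simp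
  qed
qed

definition price :: "(nat \<Rightarrow> int) \<Rightarrow> int" where
  "price X = (\<Sum>l\<in>I. phi l (X l))"

definition in_range :: "(nat \<Rightarrow> int) \<Rightarrow> bool" where
  "in_range X \<longleftrightarrow> (\<forall>l\<in>I. 0 \<le> X l \<and> X l \<le> V l)"

lemma price_nonneg: "0 \<le> price X"
  by (auto simp: price_def phi_def intro!: sum_nonneg w_nonneg)

lemma finite_coins: "finite {s. int s < V l \<and> P s}"
  by (rule finite_subset[of _ "{..<nat (V l)}"]) auto

lemma price_less:
  assumes X: "in_range X" and Y: "in_range Y" and l0: "l0 \<in> I" "Y l0 < X l0"
    and small: "\<And>l s. l \<in> I \<Longrightarrow> X l \<le> int s \<Longrightarrow> int s < Y l \<Longrightarrow> w l s < w l0 (nat (X l0 - 1))"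
  shows "price Y < price X"
proof -
  define W where "W = w l0 (nat (X l0 - 1))"
  define small where "small l = (\<Sum>s | int s < V l \<and> w l s < W. w l s)" for l
  have sn: "0 \<le> small l" for l unfolding small_def by (intro sum_nonneg w_nonneg)
  have 1: "phi l (Y l) - phi l (X l) \<le> small l" if "l \<in> I" for l
    unfolding small_def
    by (rule phi_diff_le) (use that X Y small finite_coins in \<open>auto simp: in_range_def W_def intro: less_le_trans\<close>)
  have "W \<le> phi l0 (X l0) - phi l0 (Y l0)"
  proof -
    have "sum (w l0) {nat (X l0 - 1)} \<le> (\<Sum>s | Y l0 \<le> int s \<and> int s < X l0. w l0 s)"
    proof (rule sum_mono2)
      show "finite {s. Y l0 \<le> int s \<and> int s < X l0}"
        by (rule finite_subset[of _ "{..<nat (X l0)}"]) auto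
    qed (use l0 Y w_nonneg in \<open>auto simp: in_range_def\<close>)
    then show ?thesis using l0 Y by (subst phi_diff_eq) (auto simp: W_def in_range_def)
  qed
  then have 2: "phi l0 (Y l0) - phi l0 (X l0) \<le> small l0 - W" using sn[of l0] by simp
  have "price Y - price X = (\<Sum>l\<in>I. phi l (Y l) - phi l (X l))"
    by (simp add: price_def sum_subtractf)
  also have "\<dots> \<le> (\<Sum>l\<in>I. small l - (if l = l0 then W else 0))"
    by (rule sum_mono) (use 1 2 in auto)
  also have "\<dots> = (\<Sum>l\<in>I. small l) - W" using l0 finI by (simp add: sum_subtractf)
  also have "\<dots> < 0"
  proof -
    have "0 \<le> Y l0" "X l0 \<le> V l0" using X Y l0 by (auto simp: in_range_def)
    then have "int (nat (X l0 - 1)) < V l0" using l0 by simp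
    then show ?thesis unfolding small_def W_def using w_super[OF l0(1)] by simp
  qed
  finally show ?thesis by simp
qed

lemma top_difference:
  assumes X: "in_range X" and Y: "in_range Y" and ne: "\<exists>l\<in>I. X l \<noteq> Y l"
  shows "\<exists>l0\<in>I. X l0 \<noteq> Y l0 \<and> (\<forall>l\<in>I. l \<noteq> l0 \<longrightarrow> X l = Y l \<or>
    (\<forall>s. int s < max (X l) (Y l) \<longrightarrow> w l s < w l0 (nat (max (X l0) (Y l0) - 1))))"
proof -
  define M where "M l = nat (max (X l) (Y l) - 1)" for l
  define D where "D = {l \<in> I. X l \<noteq> Y l}"
  have D: "finite D" "D \<noteq> {}" using finI ne by (auto simp: D_def)
  obtain l0 where l0: "l0 \<in> D" "\<And>l. l \<in> D \<Longrightarrow> w l (M l) \<le> w l0 (M l0)"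
  proof -
    have "Max ((\<lambda>l. w l (M l)) ` D) \<in> (\<lambda>l. w l (M l)) ` D"
      by (rule Max_in) (use D in auto)
    then obtain l where "l \<in> D" "w l (M l) = Max ((\<lambda>l. w l (M l)) ` D)" by force
    then show thesis using D by (intro that[of l]) auto
  qed
  have inV: "int (M l) < V l" if "l \<in> D" for l
  proof -
    have "0 \<le> X l" "X l \<le> V l" "0 \<le> Y l" "Y l \<le> V l" "X l \<noteq> Y l"
      using that X Y by (auto simp: in_range_def D_def)
    then show ?thesis by (auto simp: M_def)
  qed
  have "w l s < w l0 (M l0)" if l: "l \<in> I" "l \<noteq> l0" "X l \<noteq> Y l" and s: "int s < max (X l) (Y l)" for l s
  proof -
    have lD: "l \<in> D" using l by (auto simp: D_def)
    have "w l s \<le> w l (M l)" using l s inV[OF lD] by (intro w_mono) (auto simp: M_def)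
    moreover have "w l (M l) \<noteq> w l0 (M l0)"
      using w_class[of l l0 "M l" "M l0"] l l0 inV[OF lD] inV[OF l0(1)] by (auto simp: D_def)
    ultimately show ?thesis using l0(2)[OF lD] by simp
  qed
  then show ?thesis using l0 by (intro bexI[of _ l0]) (auto simp: D_def M_def)
qed

lemma top_difference_less:
  assumes X: "in_range X" and Y: "in_range Y" and less: "price Y < price X"
  shows "\<exists>l0\<in>I. Y l0 < X l0 \<and> (\<forall>l\<in>I. l \<noteq> l0 \<longrightarrow> X l = Y l \<or>
    (\<forall>s. int s < max (X l) (Y l) \<longrightarrow> w l s < w l0 (nat (X l0 - 1))))"
proof -
  have "\<exists>l\<in>I. X l \<noteq> Y l"
  proof (rule ccontr)
    assume "\<not> ?thesis"
    then have "price X = price Y" unfolding price_def by (intro sum.cong) auto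
    then show False using less by simp
  qed
  then obtain l0 where l0: "l0 \<in> I" "X l0 \<noteq> Y l0" and r: "\<And>l. l \<in> I \<Longrightarrow> l \<noteq> l0 \<Longrightarrow> X l = Y l \<or>
    (\<forall>s. int s < max (X l) (Y l) \<longrightarrow> w l s < w l0 (nat (max (X l0) (Y l0) - 1)))"
    using top_difference[OF X Y] by blast
  have "\<not> X l0 < Y l0"
  proof
    assume lt: "X l0 < Y l0"
    have "price X < price Y"
    proof (rule price_less[OF Y X l0(1) lt])
      fix l s assume ls: "l \<in> I" "Y l \<le> int s" "int s < X l"
      then have "l \<noteq> l0" using lt by auto
      then show "w l s < w l0 (nat (Y l0 - 1))" using r[OF ls(1)] ls lt by auto
    qed
    then show False using less by simp
  qed
  then have "Y l0 < X l0" using l0 by simp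
  then show ?thesis using r l0 by (intro bexI[of _ l0]) auto
qed

lemma price_inj:
  assumes X: "in_range X" and Y: "in_range Y" and eq: "price X = price Y" and l: "l \<in> I"
  shows "X l = Y l"
proof (rule ccontr)
  assume "X l \<noteq> Y l"
  then obtain l0 where l0: "l0 \<in> I" "X l0 \<noteq> Y l0" and r: "\<And>l. l \<in> I \<Longrightarrow> l \<noteq> l0 \<Longrightarrow> X l = Y l \<or>
    (\<forall>s. int s < max (X l) (Y l) \<longrightarrow> w l s < w l0 (nat (max (X l0) (Y l0) - 1)))"
    using top_difference[OF X Y] l by blast
  consider "X l0 < Y l0" | "Y l0 < X l0" using l0 by linarith
  then show False
  proof cases
    case lt: 1
    have "price X < price Y"
    proof (rule price_less[OF Y X l0(1) lt])
      fix l s assume ls: "l \<in> I" "Y l \<le> int s" "int s < X l"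
      then have "l \<noteq> l0" using lt by auto
      then show "w l s < w l0 (nat (Y l0 - 1))" using r[OF ls(1)] ls lt by auto
    qed
    then show False using eq by simp
  next
    case lt: 2
    have "price Y < price X"
    proof (rule price_less[OF X Y l0(1) lt])
      fix l s assume ls: "l \<in> I" "X l \<le> int s" "int s < Y l"
      then have "l \<noteq> l0" using lt by auto
      then show "w l s < w l0 (nat (X l0 - 1))" using r[OF ls(1)] ls lt by auto
    qed
    then show False using eq by simp
  qed
qed

definition feas :: "(nat \<Rightarrow> int) \<Rightarrow> bool" where
  "feas x \<longleftrightarrow> in_range (slack v0 x)"

definition cost1 :: "(nat \<Rightarrow> int) \<Rightarrow> int" where
  "cost1 x = price (slack v0 x)"

definition far_below :: "(nat \<Rightarrow> int) \<Rightarrow> (nat \<Rightarrow> int) \<Rightarrow> bool" where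
  "far_below x y \<longleftrightarrow> (\<forall>l\<in>I. x l < y l)"

definition chain :: "nat \<Rightarrow> (nat \<Rightarrow> int) \<Rightarrow> (nat \<Rightarrow> nat \<Rightarrow> int) \<Rightarrow> bool" where
  "chain d t c \<longleftrightarrow> (\<forall>i<d. feas (c i)) \<and> below (c 0) t \<and> (\<forall>i. Suc i < d \<longrightarrow> far_below (c (Suc i)) (c i))"

definition cost :: "nat \<Rightarrow> (nat \<Rightarrow> nat \<Rightarrow> int) \<Rightarrow> int" where
  "cost d c = (\<Sum>i<d. cost1 (c i))"

definition optimal :: "nat \<Rightarrow> (nat \<Rightarrow> int) \<Rightarrow> (nat \<Rightarrow> nat \<Rightarrow> int) \<Rightarrow> bool" where
  "optimal d t c \<longleftrightarrow> chain d t c \<and> (\<forall>c'. chain d t c' \<longrightarrow> cost d c \<le> cost d c')"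

lemma cost1_nonneg: "0 \<le> cost1 x"
  by (simp add: cost1_def price_nonneg)

lemma feas_nonneg: "feas x \<Longrightarrow> nonneg v0 x"
  by (auto simp: feas_def in_range_def nonneg_def)

lemma feas_meet_join:
  assumes "feas x" "feas y"
  shows feas_meet: "feas (meet x y)" and feas_join: "feas (join x y)"
    and cost1_submodular: "cost1 (meet x y) + cost1 (join x y) \<le> cost1 x + cost1 y"
proof -
  have *: "0 \<le> slack v0 x l \<and> slack v0 x l \<le> V l \<and> 0 \<le> slack v0 y l \<and> slack v0 y l \<le> V l"
    if "l \<in> I" for l using assms that by (auto simp: feas_def in_range_def)
  show "feas (meet x y)" "feas (join x y)"
    using * slack_meet_join[of _ v0 x y] unfolding feas_def in_range_def by (smt (verit))+
  have "phi l (slack v0 (meet x y) l) + phi l (slack v0 (join x y) l)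
      \<le> phi l (slack v0 x l) + phi l (slack v0 y l)" if "l \<in> I" for l
    by (rule phi_convex[OF that])
       (use * slack_meet_join[of l v0 x y] that in auto)
  then show "cost1 (meet x y) + cost1 (join x y) \<le> cost1 x + cost1 y"
    by (auto simp: cost1_def price_def simp flip: sum.distrib intro!: sum_mono)
qed

lemma cost1_inj:
  assumes "feas x" "feas y" "cost1 x = cost1 y" "l \<in> I"
  shows "slack v0 x l = slack v0 y l" "x l = y l"
proof -
  have *: "slack v0 x l = slack v0 y l" if "l \<in> I" for l
    using price_inj[of "slack v0 x" "slack v0 y"] assms that by (auto simp: feas_def cost1_def)
  then show "slack v0 x l = slack v0 y l" using assms by simp
  show "x l = y l"
    by (rule cyclic_eq) (use * assms in \<open>auto simp: slack_def\<close>)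
qed

lemma cost_update:
  assumes "i < d"
  shows "cost d (c(i := x)) = cost d c - cost1 (c i) + cost1 x"
proof -
  have "cost d (c(i := x)) = cost1 x + (\<Sum>k\<in>{..<d} - {i}. cost1 ((c(i := x)) k))"
    unfolding cost_def by (subst sum.remove[of _ i]) (use assms in auto)
  also have "(\<Sum>k\<in>{..<d} - {i}. cost1 ((c(i := x)) k)) = (\<Sum>k\<in>{..<d} - {i}. cost1 (c k))"
    by (rule sum.cong) auto
  also have "\<dots> = cost d c - cost1 (c i)"
    unfolding cost_def by (subst sum.remove[of "{..<d}" i]) (use assms in auto)
  finally show ?thesis by linarith
qed

lemma chain_update:
  assumes "chain d t c" "i < d" "feas x" "i = 0 \<Longrightarrow> below x t"
    "\<And>k. i = Suc k \<Longrightarrow> far_below x (c k)" "Suc i < d \<Longrightarrow> far_below (c (Suc i)) x"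
  shows "chain d t (c(i := x))"
  using assms by (auto simp: chain_def)

lemma chain_Suc: "chain (Suc d) t c \<Longrightarrow> chain d (\<lambda>l. c 0 l - 1) (\<lambda>i. c (Suc i))" if "d > 0"
  using that by (auto simp: chain_def below_def far_below_def)

lemma chain_meet: "chain d t c \<Longrightarrow> chain d t h \<Longrightarrow> chain d t (\<lambda>i. meet (c i) (h i))"
  unfolding chain_def using feas_meet
  by (auto simp: below_def far_below_def) (metis min.strict_coboundedI1 min.strict_coboundedI2 min_less_iff_conj | fastforce)+

lemma optimal_exists:
  assumes "chain d t c"
  shows "\<exists>c. optimal d t c"
proof -
  obtain x where x: "chain d t x" and m: "\<And>y. chain d t y \<Longrightarrow> nat (cost d x) \<le> nat (cost d y)"
    using ex_has_least_nat[of "chain d t" c "\<lambda>c. nat (cost d c)"] assms by blast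
  have "0 \<le> cost d y" for y by (auto simp: cost_def intro: sum_nonneg cost1_nonneg)
  then have "cost d x \<le> cost d y" if "chain d t y" for y
    using m[OF that] by (simp add: nat_le_eq_zle)
  then show ?thesis using x by (auto simp: optimal_def)
qed

text \<open>
  If \<open>D\<close> is the difference of two consecutive members \<open>x\<close> and \<open>y\<close>, let \<open>E\<close> be the greatest vector
  below \<open>D\<close> with nonnegative slack. By convexity, \<open>y + E\<close> and \<open>x - E\<close> together cost at most
  as much as \<open>x\<close> and \<open>y\<close>. Hence replacing \<open>x\<close> by the former or \<open>y\<close> by the latter does not
  increase the cost, and optimality forces equality.
\<close>

lemma optimal_slack_antimono:
  assumes opt: "optimal d t c" and i: "Suc i < d" and l: "l \<in> I"
  shows "slack v0 (c (Suc i)) l \<le> slack v0 (c i) l"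
proof -
  have ch: "chain d t c" using opt by (simp add: optimal_def)
  define D where "D l = c i l - c (Suc i) l" for l
  have "far_below (c (Suc i)) (c i)" using ch i by (simp add: chain_def)
  then have D1: "1 \<le> D l" if "l \<in> I" for l
    using that by (force simp: far_below_def D_def)
  obtain E where E: "top_below (\<lambda>_. 0) D E"
    using top_below_exists[of "\<lambda>_. 1" D "\<lambda>_. 0"] D1 p2
    by (auto simp: below_def nonneg_def slack_def)
  have "below (\<lambda>_. 1) D" "nonneg (\<lambda>_. 0) (\<lambda>_. 1)"
    using D1 p2 by (auto simp: below_def nonneg_def slack_def)
  then have "below (\<lambda>_. 1) E" using E unfolding top_below_def by blast
  then have E1: "1 \<le> E l" "E l \<le> D l" if "l \<in> I" for l
    using E that by (auto simp: top_below_def below_def)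
  define e where "e = slack (\<lambda>_. 0) E"
  have e0: "0 \<le> e l" if "l \<in> I" for l
    using E that by (auto simp: e_def top_below_def nonneg_def)
  have eD: "e l \<le> max 0 (slack v0 (c i) l - slack v0 (c (Suc i)) l)" if "l \<in> I" for l
    using top_below_slack[OF E that] by (simp add: e_def slack_def D_def algebra_simps)
  define x1 where "x1 l = c (Suc i) l + E l" for l
  define x2 where "x2 l = c i l - E l" for l
  have s1: "slack v0 x1 l = slack v0 (c (Suc i)) l + e l" and s2: "slack v0 x2 l = slack v0 (c i) l - e l" for l
    by (auto simp: slack_def x1_def x2_def e_def algebra_simps)
  have rng: "0 \<le> slack v0 (c i) l \<and> slack v0 (c i) l \<le> V l \<and>
      0 \<le> slack v0 (c (Suc i)) l \<and> slack v0 (c (Suc i)) l \<le> V l" if "l \<in> I" for l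
    using ch i that by (auto simp: chain_def feas_def in_range_def)
  have between: "slack v0 x1 l + slack v0 x2 l = slack v0 (c i) l + slack v0 (c (Suc i)) l"
    "min (slack v0 (c i) l) (slack v0 (c (Suc i)) l) \<le> slack v0 x1 l"
    "slack v0 x1 l \<le> max (slack v0 (c i) l) (slack v0 (c (Suc i)) l)"
    if "l \<in> I" for l
    using e0[OF that] eD[OF that] by (auto simp: s1 s2)
  have f1: "feas x1" unfolding feas_def in_range_def
  proof (intro ballI)
    fix l assume l: "l \<in> I"
    show "0 \<le> slack v0 x1 l \<and> slack v0 x1 l \<le> V l" using between[OF l] rng[OF l] by linarith
  qed
  have f2: "feas x2" unfolding feas_def in_range_def
  proof (intro ballI)
    fix l assume l: "l \<in> I"
    show "0 \<le> slack v0 x2 l \<and> slack v0 x2 l \<le> V l" using between[OF l] rng[OF l] by linarith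
  qed
  have sum: "cost1 x1 + cost1 x2 \<le> cost1 (c i) + cost1 (c (Suc i))"
    unfolding cost1_def price_def sum.distrib[symmetric]
  proof (rule sum_mono)
    fix l assume l: "l \<in> I"
    show "phi l (slack v0 x1 l) + phi l (slack v0 x2 l) \<le> phi l (slack v0 (c i) l) + phi l (slack v0 (c (Suc i)) l)"
      by (rule phi_convex[OF l between[OF l]]) (use rng[OF l] in auto)
  qed
  have "chain d t (c(i := x1))"
  proof (rule chain_update[OF ch])
    show "below x1 t" if "i = 0"
      using that ch E1 by (auto simp: chain_def below_def x1_def D_def) (smt (verit))
    show "far_below x1 (c k)" if "i = Suc k" for k
    proof -
      have "far_below (c i) (c k)" using ch i that by (auto simp: chain_def)
      then show ?thesis using E1 by (auto simp: far_below_def x1_def D_def) (smt (verit))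
    qed
    show "far_below (c (Suc i)) x1" using E1 by (auto simp: far_below_def x1_def) (smt (verit))
  qed (use i f1 in auto)
  then have "cost d c \<le> cost d (c(i := x1))" using opt by (auto simp: optimal_def)
  then have c1: "cost1 (c i) \<le> cost1 x1" using i by (simp add: cost_update)
  have "chain d t (c(Suc i := x2))"
  proof (rule chain_update[OF ch])
    show "far_below x2 (c k)" if "Suc i = Suc k" for k
      using E1 that by (auto simp: far_below_def x2_def) (smt (verit))
    show "far_below (c (Suc (Suc i))) x2" if "Suc (Suc i) < d"
    proof -
      have "far_below (c (Suc (Suc i))) (c (Suc i))" using ch that by (auto simp: chain_def)
      then show ?thesis using E1 by (auto simp: far_below_def x2_def D_def) (smt (verit))
    qed
  qed (use i f2 in auto)
  then have "cost d c \<le> cost d (c(Suc i := x2))" using opt by (auto simp: optimal_def)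
  then have "cost1 (c (Suc i)) \<le> cost1 x2" using i by (simp add: cost_update)
  then have "cost1 x1 = cost1 (c i)" using c1 sum by simp
  then have "slack v0 x1 l = slack v0 (c i) l"
    using cost1_inj(1)[OF f1 _ _ l] ch i by (auto simp: chain_def)
  then show ?thesis using s1[of l] e0[OF l] by simp
qed

text \<open>
  The new chain \<open>u\<close> is the greatest relaxed chain below \<open>c\<close> with \<open>u 0\<close> below \<open>join (h 0) (c 0 - 1)\<close>.
  In each class \<open>l\<close> the count \<open>a' i l\<close> exceeds the old count \<open>a i l\<close> by at most one (the indices
  \<open>inc l\<close>), each time by a different coin, and these coins are worth less than \<open>W\<close>, the
  most valuable coin used by \<open>c 0\<close> but not by \<open>h 0\<close>.
\<close>

lemma exchange:
  assumes c: "chain (Suc d) t c" and h: "chain (Suc d) t h"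
    and antimono: "\<And>i l. Suc i < Suc d \<Longrightarrow> l \<in> I \<Longrightarrow> slack v0 (c (Suc i)) l \<le> slack v0 (c i) l"
    and hc: "below (h 0) (c 0)" and ch: "d > 0 \<Longrightarrow> below (c 1) (h 0)"
    and less: "cost1 (h 0) < cost1 (c 0)"
    and least: "\<And>y. chain (Suc d) t y \<Longrightarrow> cost1 (h 0) \<le> cost1 (y 0)"
  shows "\<exists>c'. chain (Suc d) t c' \<and> cost (Suc d) c' < cost (Suc d) c"
proof -
  define X where "X = slack v0 (c 0)"
  define Y where "Y = slack v0 (h 0)"
  have feas_c: "feas (c i)" if "i \<le> d" for i using c that by (auto simp: chain_def)
  have feas_h: "feas (h i)" if "i \<le> d" for i using h that by (auto simp: chain_def)
  have dec_c: "c (Suc i) l < c i l" if "i < d" "l \<in> I" for i l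
    using c that by (auto simp: chain_def far_below_def)
  have dec_h: "h (Suc i) l < h i l" if "i < d" "l \<in> I" for i l
    using h that by (auto simp: chain_def far_below_def)
  have X: "in_range X" and Y: "in_range Y" using feas_c feas_h by (auto simp: X_def Y_def feas_def)
  have X01: "0 \<le> X l" "X l \<le> V l" "0 \<le> Y l" "Y l \<le> V l" if "l \<in> I" for l
    using X Y that by (auto simp: in_range_def)
  have "price Y < price X" using less by (simp add: cost1_def X_def Y_def)
  then obtain j where j: "j \<in> I" "Y j < X j" and away: "\<And>l. l \<in> I \<Longrightarrow> l \<noteq> j \<Longrightarrow> X l = Y l \<or>
      (\<forall>s. int s < max (X l) (Y l) \<longrightarrow> w l s < w j (nat (X j - 1)))"
    using top_difference_less[OF X Y] by blast
  define W where "W = w j (nat (X j - 1))"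
  have nj: "int (nat (X j - 1)) = X j - 1" using j X01[of j] by simp
  have c0h0: "h 0 l \<le> c 0 l" if "l \<in> I" for l using hc that by (auto simp: below_def)

  define s0 where "s0 = join (h 0) (\<lambda>l. c 0 l - 1)"
  define u where "u = rec_nat (SOME x. top_below v0 s0 x)
    (\<lambda>i y. SOME x. top_below v0 (meet (c (Suc i)) (\<lambda>l. y l - 1)) x)"
  define st where "st i = (case i of 0 \<Rightarrow> s0 | Suc n \<Rightarrow> meet (c (Suc n)) (\<lambda>l. u n l - 1))" for i
  have u_some: "u i = (SOME x. top_below v0 (st i) x)" for i
    by (cases i) (auto simp: u_def st_def)
  have u_top: "top_below v0 (st i) (u i)" if "below b (st i)" "nonneg v0 b" for i b
    using someI_ex[OF top_below_exists[OF that]] by (simp flip: u_some)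
  have inv: "top_below v0 (st i) (u i) \<and> below (meet (h i) (c i)) (u i) \<and>
      (i < d \<longrightarrow> below (c (Suc i)) (u i))" if "i \<le> d" for i
    using that
  proof (induction i)
    case 0
    have "below (h 0) (st 0)" by (auto simp: below_def st_def s0_def)
    then have t: "top_below v0 (st 0) (u 0)" and hu: "below (h 0) (u 0)"
      using u_top[of "h 0" 0] feas_nonneg[OF feas_h[of 0]] by (auto simp: top_below_def)
    then show ?case using ch hu by (fastforce simp: below_def)
  next
    case (Suc i)
    define b where "b = meet (h (Suc i)) (c (Suc i))"
    have IH: "below (meet (h i) (c i)) (u i)" "below (c (Suc i)) (u i)" using Suc by auto
    have nb: "nonneg v0 b" unfolding b_def using Suc.prems
      by (intro feas_nonneg feas_meet feas_h feas_c) auto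
    have "below b (st (Suc i))" unfolding below_def
    proof
      fix l assume l: "l \<in> I"
      have "min (h i l) (c i l) \<le> u i l" using IH(1) l by (auto simp: below_def)
      then show "b l \<le> st (Suc i) l"
        using dec_c[of i l] dec_h[of i l] Suc.prems l by (auto simp: b_def st_def min_def split: if_splits)
    qed
    then have t: "top_below v0 (st (Suc i)) (u (Suc i))" and bu: "below b (u (Suc i))"
      using u_top nb by (auto simp: top_below_def)
    have "below (c (Suc (Suc i))) (u (Suc i))" if "Suc i < d"
    proof -
      have "below (c (Suc (Suc i))) (st (Suc i))" unfolding below_def
      proof
        fix l assume l: "l \<in> I"
        have "c (Suc i) l \<le> u i l" using IH(2) l by (auto simp: below_def)
        then show "c (Suc (Suc i)) l \<le> st (Suc i) l"
          using dec_c[of "Suc i" l] that l by (auto simp: st_def)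
      qed
      then show ?thesis using t that feas_nonneg[OF feas_c[of "Suc (Suc i)"]] by (auto simp: top_below_def)
    qed
    then show ?case using t bu by (auto simp: b_def)
  qed
  have u_top: "top_below v0 (st i) (u i)" if "i \<le> d" for i using inv that by blast
  have u_st: "u i l \<le> st i l" if "i \<le> d" "l \<in> I" for i l
    using u_top[of i] that by (auto simp: top_below_def below_def)
  have cu: "c (Suc i) l \<le> u i l" if "i < d" "l \<in> I" for i l
    using inv[of i] that by (auto simp: below_def)

  define a where "a i l = slack v0 (c i) l" for i l
  define a' where "a' i l = slack v0 (u i) l" for i l
  have a0: "a 0 l = X l" for l by (simp add: a_def X_def)
  have a01: "0 \<le> a i l" "a i l \<le> V l" if "i \<le> d" "l \<in> I" for i l
    using feas_c[OF that(1)] that by (auto simp: feas_def in_range_def a_def)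
  have a_dec: "a (Suc i) l \<le> a i l" if "i < d" "l \<in> I" for i l
    using antimono that by (auto simp: a_def)
  have a_mono: "a k l \<le> a i l" if "i \<le> k" "k \<le> d" "l \<in> I" for i k l
    using that(1,2)
  proof (induction k rule: dec_induct)
    case (step n)
    then show ?case using a_dec[of n l] that by auto
  qed simp
  have a'0: "0 \<le> a' i l" if "i \<le> d" "l \<in> I" for i l
    using u_top[OF that(1)] that by (auto simp: top_below_def nonneg_def a'_def)
  have tight: "u i (pr l) = st i (pr l) \<or> a' i l = 0" if "i \<le> d" "l \<in> I" for i l
    using u_top[OF that(1)] that by (auto simp: top_below_def a'_def)

  define e where "e l = c 0 l - s0 l" for l
  have e01: "e l = (if h 0 l = c 0 l then 0 else 1)" if "l \<in> I" for l
    using c0h0[OF that] by (auto simp: e_def s0_def)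
  have slack_s0: "slack v0 s0 l = X l - p * e l + e (pr l)" for l
    by (auto simp: slack_def X_def e_def algebra_simps)
  have s0_le1: "slack v0 s0 l \<le> X l + 1" if "l \<in> I" for l
    unfolding slack_s0 using e01[OF that] e01[OF pr_in[OF that]] p2 by (auto split: if_splits)
  have s0_le2: "slack v0 s0 l \<le> max (X l) (Y l) \<and> (e l = 1 \<longrightarrow> slack v0 s0 l < X l)
      \<and> (e l = 0 \<longrightarrow> slack v0 s0 l \<le> Y l)" if "l \<in> I" for l
  proof (cases "h 0 l = c 0 l")
    case True
    have "e (pr l) \<le> c 0 (pr l) - h 0 (pr l)"
      using e01[OF pr_in[OF that]] c0h0[OF pr_in[OF that]] by auto
    then have "slack v0 s0 l \<le> Y l"
      using True e01[OF that] by (simp add: slack_s0) (simp add: X_def Y_def slack_def)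
    then show ?thesis using e01[OF that] True by auto
  next
    case False
    then show ?thesis using e01[OF that] e01[OF pr_in[OF that]] p2 by (auto simp: slack_s0)
  qed
  have ej: "e j = 1"
  proof (rule ccontr)
    assume "e j \<noteq> 1"
    then have "h 0 j = c 0 j" using e01[OF j(1)] by (auto split: if_splits)
    then have "X j \<le> Y j" using c0h0[OF pr_in[OF j(1)]] by (simp add: X_def Y_def slack_def)
    then show False using j by simp
  qed
  have a'_0: "a' 0 l \<le> max 0 (slack v0 s0 l)" if "l \<in> I" for l
    using top_below_slack[OF u_top[of 0] that] by (simp add: a'_def st_def)
  have a'0_le1: "a' 0 l \<le> X l + 1" if "l \<in> I" for l
    using a'_0[OF that] s0_le1[OF that] X01(1)[OF that] by linarith
  have a'0_le2: "a' 0 l \<le> max (X l) (Y l)" if "l \<in> I" for l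
    using a'_0[OF that] s0_le2[OF that] X01[OF that] by linarith
  have a'0_j: "a' 0 j \<le> X j - 1"
    using a'_0[OF j(1)] s0_le2[OF j(1)] ej X01[OF j(1)] j(2) by linarith

  have step: "a' (Suc i) l \<le> a (Suc i) l \<or> (a' (Suc i) l = a (Suc i) l + 1 \<and>
      a' (Suc i) l \<le> a' i l - p + 1 \<and> u i (pr l) = c (Suc i) (pr l))" if i: "i < d" and l: "l \<in> I" for i l
  proof (cases "a' (Suc i) l \<le> a (Suc i) l")
    case False
    then have "a' (Suc i) l \<noteq> 0" using a01[of "Suc i" l] i l by auto
    then have ut: "u (Suc i) (pr l) = min (c (Suc i) (pr l)) (u i (pr l) - 1)"
      using tight[of "Suc i" l] i l by (auto simp: st_def)
    have m: "p * u (Suc i) l \<le> p * c (Suc i) l" "p * u (Suc i) l \<le> p * (u i l - 1)"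
      using u_st[of "Suc i" l] i l p2 by (auto simp: st_def)
    have "\<not> c (Suc i) (pr l) \<le> u i (pr l) - 1"
    proof
      assume "c (Suc i) (pr l) \<le> u i (pr l) - 1"
      then have "a' (Suc i) l \<le> a (Suc i) l" using m ut by (simp add: a'_def a_def slack_def)
      then show False using False by simp
    qed
    then have eq: "u i (pr l) = c (Suc i) (pr l)" using cu[OF i pr_in[OF l]] by simp
    have "a' (Suc i) l \<le> a (Suc i) l + 1" using m ut eq by (simp add: a'_def a_def slack_def)
    moreover have "a' (Suc i) l \<le> a' i l - p + 1"
      using m ut eq by (simp add: a'_def slack_def algebra_simps)
    ultimately show ?thesis using False eq by auto
  qed simp
  have a'_V: "a' i l \<le> V l" if "i \<le> d" "l \<in> I" for i l
    using that(1)
  proof (induction i)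
    case 0
    then show ?case using a'0_le2[of l] X01[of l] that by auto
  next
    case (Suc i)
    then show ?case using step[of i l] a01[of "Suc i" l] that p2 by auto
  qed
  have a'_a1: "a' i l \<le> a i l + 1" if "i \<le> d" "l \<in> I" for i l
  proof (cases i)
    case 0
    then show ?thesis using a'0_le1 that by (simp add: a0)
  next
    case (Suc k)
    then show ?thesis using step[of k l] that by auto
  qed
  have feas_u: "feas (u i)" if "i \<le> d" for i
    using a'0 a'_V that by (auto simp: feas_def in_range_def a'_def)
  have chain_u: "chain (Suc d) t u"
  proof -
    have "below (u 0) t"
      using u_st[of 0] c0h0 c by (auto simp: st_def s0_def chain_def below_def) (smt (verit))
    moreover have "far_below (u (Suc i)) (u i)" if "i < d" for i
      using u_st[of "Suc i"] that by (fastforce simp: st_def far_below_def)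
    ultimately show ?thesis using feas_u by (auto simp: chain_def)
  qed

  have large: "a' 0 l = X l \<and> X l > 0 \<and> u 0 (pr l) = c 0 (pr l)"
    if l: "l \<in> I" "l \<noteq> j" and big: "\<not> (\<forall>s. int s < max (X l) (Y l) \<longrightarrow> w l s < W)" for l
  proof -
    have XY: "X l = Y l" using away[OF l] big by (auto simp: W_def)
    obtain s where s: "int s < X l" "W \<le> w l s" using big XY by (auto simp: not_less)
    have nX: "int (nat (X l - 1)) = X l - 1" using s by simp
    have "W \<le> w l (nat (X l - 1))"
    proof -
      have "s \<le> nat (X l - 1)" "int (nat (X l - 1)) < V l" using s X01[OF l(1)] nX by auto
      then show ?thesis using w_mono[of l s] s l by fastforce
    qed
    moreover have "W \<noteq> w l (nat (X l - 1))"
      unfolding W_def using w_class[OF j(1) l(1), of "nat (X j - 1)" "nat (X l - 1)"] l nj nX X01(2)[OF l(1)] X01(2)[OF j(1)]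
      by auto
    ultimately have Wl: "W < w l (nat (X l - 1))" by simp
    have "\<not> a' 0 l < X l"
    proof
      assume lt: "a' 0 l < X l"
      have "price (slack v0 (u 0)) < price Y"
      proof (rule price_less[OF Y _ l(1)])
        show "in_range (slack v0 (u 0))" using feas_u[of 0] by (simp add: feas_def)
        show "slack v0 (u 0) l < Y l" using lt XY by (simp add: a'_def)
        fix l' s' assume l': "l' \<in> I" and s': "Y l' \<le> int s'" "int s' < slack v0 (u 0) l'"
        have "w l' s' \<le> W"
        proof (cases "l' = j")
          case True
          then show ?thesis unfolding W_def
            using s' a'0_j nj X01[OF j(1)] j by (auto simp: a'_def intro!: w_mono)
        next
          case False
          have "int s' < max (X l') (Y l')" using s' a'0_le2[OF l'] by (simp add: a'_def)
          then show ?thesis using away[OF l' False] s' by (auto simp: W_def intro: less_imp_le)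
        qed
        then show "w l' s' < w l (nat (Y l - 1))" using Wl XY by simp
      qed
      then have "cost1 (u 0) < cost1 (h 0)" by (simp add: cost1_def Y_def)
      then show False using least[OF chain_u] by simp
    qed
    then have eq: "a' 0 l = X l" using a'0_le2[OF l(1)] XY by simp
    have pos: "X l > 0" using s by simp
    have ut: "u 0 (pr l) = s0 (pr l)" using tight[of 0 l] eq pos l by (auto simp: st_def)
    have "p * u 0 l \<le> p * s0 l" using u_st[of 0 l] l p2 by (auto simp: st_def)
    then have "X l \<le> slack v0 s0 l" using eq ut by (simp add: a'_def slack_def)
    then have "e l \<noteq> 1" "slack v0 s0 l \<le> X l" "X l \<le> slack v0 s0 l" using s0_le2[OF l(1)] XY by auto
    then have "e (pr l) = 0" using e01[OF l(1)] by (auto simp: slack_s0 split: if_splits)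
    then show ?thesis using eq pos ut by (simp add: e_def)
  qed

  define inc where "inc l = {i. i \<le> d \<and> a i l < a' i l}" for l
  define small where "small l = {s. int s < V l \<and> w l s < W}" for l
  have fin_inc: "finite (inc l)" for l by (rule finite_subset[of _ "{..d}"]) (auto simp: inc_def)
  have inc_eq: "a' i l = a i l + 1" if "i \<in> inc l" "l \<in> I" for i l
    using that a'_a1[of i l] by (auto simp: inc_def)
  have inc_Suc: "a' i l \<le> a' k l - p + 1" "a i l < a k l" "u k (pr l) = c i (pr l)"
    if "i \<in> inc l" "l \<in> I" "i = Suc k" for i k l
    using that step[of k l] a'_a1[of k l] p2 by (auto simp: inc_def)
  have inc_small: "nat (a i l) \<in> small l" if i: "i \<in> inc l" and l: "l \<in> I" for i l
  proof -
    have id: "i \<le> d" using i by (simp add: inc_def)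
    have "int (nat (a i l)) < V l"
      using inc_eq[OF i l] a'_V[OF id l] a01[OF id l] by simp
    moreover have "w l (nat (a i l)) < W"
    proof (cases "l = j")
      case True
      have aX: "a' k j \<le> X j" if "k \<le> d" for k
        using that
      proof (induction k)
        case 0
        then show ?case using a'0_j by simp
      next
        case (Suc k)
        then show ?case using step[of k j] a_mono[of 0 "Suc k" j] j p2 by (auto simp: a0)
      qed
      obtain k where k: "i = Suc k"
        using i a'0_j True by (cases i) (auto simp: inc_def a0)
      have "a i l + 1 \<le> X j - p + 1"
        using inc_Suc(1)[OF i l k] inc_eq[OF i l] aX[of k] k id True by simp
      then show ?thesis unfolding W_def True
        using True nj a01[OF id l] X01[OF j(1)] j by (intro w_gap) auto
    next
      case False
      show ?thesis
      proof (cases "\<forall>s. int s < max (X l) (Y l) \<longrightarrow> w l s < W")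
        case True
        have "a i l < max (X l) (Y l)"
        proof (cases i)
          case 0
          then show ?thesis using i a'0_le2[OF l] by (auto simp: inc_def)
        next
          case (Suc k)
          then show ?thesis using inc_Suc(2)[OF i l Suc] a_mono[of 0 k l] id l by (auto simp: a0)
        qed
        then show ?thesis using True a01[OF id l] by auto
      next
        case big: False
        note lg = large[OF l False big]
        have Q: "a' k l = 0 \<or> u k (pr l) = c k (pr l)" if "k \<le> d" for k
          using that
        proof (induction k)
          case 0
          then show ?case using lg by simp
        next
          case (Suc k)
          show ?case
          proof (rule ccontr)
            assume neg: "\<not> ?case"
            then have "u (Suc k) (pr l) = min (c (Suc k) (pr l)) (u k (pr l) - 1)"
              using tight[of "Suc k" l] Suc.prems l by (auto simp: st_def)
            then have lt: "u (Suc k) (pr l) = u k (pr l) - 1" "u k (pr l) \<le> c (Suc k) (pr l)"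
              using neg by auto
            have "p * u (Suc k) l \<le> p * (u k l - 1)"
              using u_st[of "Suc k" l] Suc.prems l p2 by (auto simp: st_def)
            then have "a' (Suc k) l \<le> a' k l - p + 1"
              using lt by (simp add: a'_def slack_def algebra_simps)
            then have "a' k l \<noteq> 0" using a'0[of "Suc k" l] neg Suc.prems l p2 by auto
            then have "u k (pr l) = c k (pr l)" using Suc by auto
            then show False using lt dec_c[of k "pr l"] pr_in[OF l] Suc.prems by auto
          qed
        qed
        obtain k where k: "i = Suc k"
          using i lg by (cases i) (auto simp: inc_def a0)
        have "a' k l \<noteq> 0"
          using inc_Suc(1)[OF i l k] a'0[OF id l] inc_eq[OF i l] a01[OF id l] p2 by auto
        then have "u k (pr l) = c k (pr l)" using Q[of k] k id by auto
        then show ?thesis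
          using inc_Suc(3)[OF i l k] dec_c[of k "pr l"] pr_in[OF l] k id by auto
      qed
    qed
    ultimately show ?thesis by (simp add: small_def)
  qed
  have inc_inj: "inj_on (\<lambda>i. nat (a i l)) (inc l)" if l: "l \<in> I" for l
  proof -
    have "a k l < a i l" if i: "i \<in> inc l" and k: "k \<in> inc l" and ik: "i < k" for i k
    proof -
      obtain k' where k': "k = Suc k'" using ik by (cases k) auto
      have "a k l < a k' l" using inc_Suc(2)[OF k l k'] .
      also have "\<dots> \<le> a i l" using a_mono[of i k' l] ik k k' l by (auto simp: inc_def)
      finally show ?thesis .
    qed
    then have "nat (a k l) \<noteq> nat (a i l)" if "i \<in> inc l" "k \<in> inc l" "i < k" for i k
      using that a01[of k l] l by (fastforce simp: inc_def)
    then show ?thesis by (auto simp: inj_on_def) (metis nat_neq_iff)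
  qed
  have class_bound: "(\<Sum>i\<le>d. phi l (a' i l) - phi l (a i l)) \<le> sum (w l) (small l) - (if l = j then W else 0)"
    if l: "l \<in> I" for l
  proof -
    have "phi l (a' i l) - phi l (a i l) \<le>
       (if i \<in> inc l then w l (nat (a i l)) else 0) - (if i = 0 then if l = j then W else 0 else 0)"
      if i: "i \<le> d" for i
    proof (cases "i = 0 \<and> l = j")
      case True
      have "phi l (a' i l) \<le> phi l (X j - 1)"
        using True a'0_j a'0[of 0 j] j by (auto intro!: phi_mono)
      moreover have "phi j (X j) - phi j (X j - 1) \<ge> W"
      proof -
        have "{s. X j - 1 \<le> int s \<and> int s < X j} = {nat (X j - 1)}" using nj by auto
        then show ?thesis using nj by (subst phi_diff_eq) (auto simp: W_def)
      qed
      moreover have "i \<notin> inc l" using True a'0_j by (auto simp: inc_def a0)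
      ultimately show ?thesis using True by (simp add: a0)
    next
      case False
      show ?thesis
      proof (cases "i \<in> inc l")
        case True
        have "phi l (a' i l) - phi l (a i l) \<le> sum (w l) {nat (a i l)}"
          using inc_eq[OF True l] a01[OF i l] by (intro phi_diff_le) auto
        then show ?thesis using True False by auto
      next
        case notin: False
        have "phi l (a' i l) \<le> phi l (a i l)"
          using notin i a'0[OF i l] by (auto simp: inc_def intro!: phi_mono)
        then show ?thesis using notin False by auto
      qed
    qed
    then have "(\<Sum>i\<le>d. phi l (a' i l) - phi l (a i l)) \<le>
       (\<Sum>i\<le>d. (if i \<in> inc l then w l (nat (a i l)) else 0) - (if i = 0 then if l = j then W else 0 else 0))"
      by (intro sum_mono) auto
    also have "\<dots> = (\<Sum>i\<le>d. if i \<in> inc l then w l (nat (a i l)) else 0) - (if l = j then W else 0)"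
      by (simp add: sum_subtractf)
    also have "(\<Sum>i\<le>d. if i \<in> inc l then w l (nat (a i l)) else 0) = (\<Sum>i\<in>inc l. w l (nat (a i l)))"
      by (rule sum.mono_neutral_cong_right) (auto simp: inc_def)
    also have "\<dots> = sum (w l) ((\<lambda>i. nat (a i l)) ` inc l)"
      using inc_inj[OF l] by (simp add: sum.reindex)
    also have "\<dots> \<le> sum (w l) (small l)"
      by (rule sum_mono2) (use inc_small l w_nonneg finite_coins in \<open>auto simp: small_def\<close>)
    finally show ?thesis by simp
  qed
  have "cost (Suc d) u - cost (Suc d) c = (\<Sum>i\<le>d. \<Sum>l\<in>I. phi l (a' i l) - phi l (a i l))"
    by (simp add: cost_def cost1_def price_def a_def a'_def sum_subtractf lessThan_Suc_atMost)
  also have "\<dots> = (\<Sum>l\<in>I. \<Sum>i\<le>d. phi l (a' i l) - phi l (a i l))" by (rule sum.swap)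
  also have "\<dots> \<le> (\<Sum>l\<in>I. sum (w l) (small l) - (if l = j then W else 0))"
    by (rule sum_mono) (rule class_bound)
  also have "\<dots> = (\<Sum>l\<in>I. sum (w l) (small l)) - W" using j finI by (simp add: sum_subtractf)
  also have "\<dots> < 0"
  proof -
    have "int (nat (X j - 1)) < V j" using nj X01[OF j(1)] by simp
    then show ?thesis unfolding small_def W_def using w_super[OF j(1)] by simp
  qed
  finally show ?thesis using chain_u by (intro exI[of _ u]) simp
qed

theorem optimal_top_least:
  assumes "optimal (Suc d) t c" and "chain (Suc d) t h"
  shows "cost1 (c 0) \<le> cost1 (h 0)"
  using assms
proof (induction d arbitrary: t c h)
  case 0
  then show ?case by (auto simp: optimal_def cost_def)
next
  case (Suc d)
  have c: "chain (Suc (Suc d)) t c" using Suc.prems by (simp add: optimal_def)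
  obtain g where g: "chain (Suc (Suc d)) t g"
    and least: "\<And>y. chain (Suc (Suc d)) t y \<Longrightarrow> cost1 (g 0) \<le> cost1 (y 0)"
  proof -
    obtain g where "chain (Suc (Suc d)) t g"
      and m: "\<And>y. chain (Suc (Suc d)) t y \<Longrightarrow> nat (cost1 (g 0)) \<le> nat (cost1 (y 0))"
      using ex_has_least_nat[of "chain (Suc (Suc d)) t" c "\<lambda>c. nat (cost1 (c 0))"] c by blast
    then show thesis using cost1_nonneg by (intro that[of g]) (auto simp: nat_le_eq_zle)
  qed
  have feas0: "feas (c 0)" "feas (g 0)" "feas (c 1)" using c g by (auto simp: chain_def)
  have gc: "below (g 0) (c 0)"
  proof -
    have "chain (Suc (Suc d)) t (c(0 := join (g 0) (c 0)))"
    proof (rule chain_update[OF c])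
      show "feas (join (g 0) (c 0))" using feas0 by (intro feas_join)
      show "below (join (g 0) (c 0)) t" using c g by (auto simp: chain_def below_def)
      have "far_below (c (Suc 0)) (c 0)" using c by (auto simp: chain_def)
      then show "far_below (c (Suc 0)) (join (g 0) (c 0))" by (fastforce simp: far_below_def)
    qed auto
    then have "cost (Suc (Suc d)) c \<le> cost (Suc (Suc d)) (c(0 := join (g 0) (c 0)))"
      using Suc.prems by (auto simp: optimal_def)
    then have 1: "cost1 (c 0) \<le> cost1 (join (g 0) (c 0))" by (simp add: cost_update)
    have 2: "cost1 (g 0) \<le> cost1 (meet (g 0) (c 0))" using least[OF chain_meet[OF g c]] .
    have "cost1 (meet (g 0) (c 0)) = cost1 (g 0)" using cost1_submodular[OF feas0(2,1)] 1 2 by simp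
    then have "meet (g 0) (c 0) l = g 0 l" if "l \<in> I" for l
      using cost1_inj(2)[OF feas_meet[OF feas0(2,1)] feas0(2) _ that] by simp
    then show ?thesis by (fastforce simp: below_def min_def split: if_splits)
  qed
  have cg: "below (c 1) (g 0)"
  proof -
    define t' where "t' = (\<lambda>l. c 0 l - 1)"
    have c': "chain (Suc d) t' (\<lambda>i. c (Suc i))" unfolding t'_def using chain_Suc[OF _ c] by simp
    have "optimal (Suc d) t' (\<lambda>i. c (Suc i))"
      unfolding optimal_def
    proof (intro conjI allI impI)
      fix x assume x: "chain (Suc d) t' x"
      define y where "y = case_nat (c 0) x"
      have "chain (Suc (Suc d)) t y"
        unfolding chain_def
      proof (intro conjI allI impI)
        show "feas (y i)" if "i < Suc (Suc d)" for i
          using that x feas0 by (cases i) (auto simp: y_def chain_def)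
        show "below (y 0) t" using c by (simp add: y_def chain_def)
        show "far_below (y (Suc i)) (y i)" if "Suc i < Suc (Suc d)" for i
          using that x by (cases i) (auto simp: y_def chain_def t'_def below_def far_below_def)
      qed
      then have "cost (Suc (Suc d)) c \<le> cost (Suc (Suc d)) y" using Suc.prems by (auto simp: optimal_def)
      then show "cost (Suc d) (\<lambda>i. c (Suc i)) \<le> cost (Suc d) x"
        unfolding cost_def by (simp add: sum.lessThan_Suc_shift y_def del: sum.lessThan_Suc)
    qed (rule c')
    moreover have "chain (Suc d) t' (\<lambda>i. meet (c (Suc i)) (g i))"
      unfolding chain_def
    proof (intro conjI allI impI)
      show "feas (meet (c (Suc i)) (g i))" if "i < Suc d" for i
        using that c g by (intro feas_meet) (auto simp: chain_def)
      show "below (meet (c (Suc 0)) (g 0)) t'" using c' by (auto simp: chain_def below_def)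
      show "far_below (meet (c (Suc (Suc i))) (g (Suc i))) (meet (c (Suc i)) (g i))" if "Suc i < Suc d" for i
      proof -
        have "far_below (c (Suc (Suc i))) (c (Suc i))" "far_below (g (Suc i)) (g i)"
          using c g that by (auto simp: chain_def)
        then show ?thesis by (force simp: far_below_def min_def)
      qed
    qed
    ultimately have 1: "cost1 (c 1) \<le> cost1 (meet (c 1) (g 0))"
      using Suc.IH by fastforce
    have "chain (Suc (Suc d)) t (g(0 := join (c 1) (g 0)))"
    proof (rule chain_update[OF g])
      show "feas (join (c 1) (g 0))" using feas0 by (intro feas_join)
      have "far_below (c 1) (c 0)" using c by (auto simp: chain_def)
      then show "below (join (c 1) (g 0)) t"
        using c g by (fastforce simp: chain_def below_def far_below_def)
      have "far_below (g (Suc 0)) (g 0)" using g by (auto simp: chain_def)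
      then show "far_below (g (Suc 0)) (join (c 1) (g 0))" by (fastforce simp: far_below_def)
    qed auto
    then have 2: "cost1 (g 0) \<le> cost1 (join (c 1) (g 0))" using least by fastforce
    have "cost1 (meet (c 1) (g 0)) = cost1 (c 1)" using cost1_submodular[OF feas0(3,2)] 1 2 by simp
    then have "meet (c 1) (g 0) l = c 1 l" if "l \<in> I" for l
      using cost1_inj(2)[OF feas_meet[OF feas0(3,2)] feas0(3) _ that] by simp
    then show ?thesis by (fastforce simp: below_def min_def split: if_splits)
  qed
  have "\<not> cost1 (g 0) < cost1 (c 0)"
  proof
    assume lt: "cost1 (g 0) < cost1 (c 0)"
    have "\<exists>c'. chain (Suc (Suc d)) t c' \<and> cost (Suc (Suc d)) c' < cost (Suc (Suc d)) c"
      by (rule exchange[where h = g])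
        (use c g gc cg lt least optimal_slack_antimono[OF Suc.prems(1)] in auto)
    then show False using Suc.prems(1) by (fastforce simp: optimal_def)
  qed
  then show ?case using least[OF Suc.prems(2)] by simp
qed

end

section \<open>Digits and carry-free decompositions\<close>

lemma digit_less: "p > 0 \<Longrightarrow> digit p n e < p"
  by (simp add: digit_def)

lemma digit_0_left [simp]: "digit p 0 e = 0"
  by (simp add: digit_def)

lemma sum_digits_mod: "(\<Sum>e<M. digit p n e * p ^ e) = n mod p ^ M"
proof (induction M)
  case (Suc M)
  have "n mod p ^ Suc M = p ^ M * (n div p ^ M mod p) + n mod p ^ M"
    by (metis mod_mult2_eq power_Suc2)
  then show ?case using Suc by (simp add: digit_def)
qed simp

lemma sum_digits: "n < p ^ M \<Longrightarrow> (\<Sum>e<M. digit p n e * p ^ e) = n"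
  by (simp add: sum_digits_mod)

lemma digit_eq_0: "n < p ^ M \<Longrightarrow> M \<le> e \<Longrightarrow> p > 0 \<Longrightarrow> digit p n e = 0"
  using power_increasing[of M e p] by (auto simp: digit_def)

lemma digit_sum:
  assumes "\<And>e. b e < p"
  shows "digit p (\<Sum>e<M. b e * p ^ e) e = (if e < M then b e else 0)"
  using assms
proof (induction M arbitrary: b e)
  case (Suc M)
  define S where "S = (\<Sum>e<M. b (Suc e) * p ^ e)"
  have p: "0 < p" using Suc.prems[of 0] by linarith
  have eq: "(\<Sum>e<Suc M. b e * p ^ e) = b 0 + p * S"
    by (simp add: S_def sum.lessThan_Suc_shift sum_distrib_left algebra_simps del: sum.lessThan_Suc)
  show ?case
  proof (cases e)
    case 0
    then show ?thesis unfolding eq using Suc.prems[of 0] by (simp add: digit_def)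
  next
    case (Suc e')
    have "digit p (b 0 + p * S) e = digit p S e'"
      unfolding Suc digit_def using Suc.prems[of 0] p by (simp add: div_mult2_eq)
    then show ?thesis unfolding eq using Suc.IH[of "\<lambda>e. b (Suc e)" e'] Suc.prems Suc by (simp add: S_def)
  qed
qed simp

definition submask :: "nat \<Rightarrow> nat \<Rightarrow> nat \<Rightarrow> bool" where
  "submask p n m \<longleftrightarrow> (\<forall>e. digit p n e \<le> digit p m e)"

lemma submask_refl [simp]: "submask p n n" by (simp add: submask_def)

lemma submask_trans: "submask p a b \<Longrightarrow> submask p b c \<Longrightarrow> submask p a c"
  unfolding submask_def by (meson order_trans)

lemma less_power_add: "2 \<le> p \<Longrightarrow> n < p ^ (n + m)" for p n m :: nat
  using less_exp[of "n + m"] power_mono[of 2 p "n + m"] by linarith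

lemma submask_le:
  assumes "2 \<le> p" "submask p n m"
  shows "n \<le> m"
proof -
  have "n = (\<Sum>e<n+m. digit p n e * p ^ e)" using sum_digits[OF less_power_add[OF assms(1)]] by simp
  also have "\<dots> \<le> (\<Sum>e<n+m. digit p m e * p ^ e)"
    using assms by (intro sum_mono) (auto simp: submask_def)
  also have "\<dots> = m" using sum_digits[OF less_power_add[OF assms(1), of m n]] by (simp add: add.commute)
  finally show ?thesis .
qed

lemma digit_add:
  assumes "2 \<le> p" "\<And>e. digit p a e + digit p b e < p"
  shows "digit p (a + b) e = digit p a e + digit p b e"
proof -
  define M where "M = a + b + e + 1"
  have "2 ^ (a + b + e + 1) \<le> p ^ M" unfolding M_def using assms(1) by (rule power_mono) simp
  moreover have "a + b + e + 1 < 2 ^ (a + b + e + 1)" by (rule less_exp)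
  ultimately have "a < p ^ M" "b < p ^ M" by linarith+
  then have "a + b = (\<Sum>e<M. (digit p a e + digit p b e) * p ^ e)"
    using sum_digits[of a p M] sum_digits[of b p M] by (simp add: algebra_simps sum.distrib)
  then have "digit p (a + b) e = (if e < M then digit p a e + digit p b e else 0)"
    using digit_sum[of "\<lambda>e. digit p a e + digit p b e" p M e] assms(2) by simp
  then show ?thesis by (simp add: M_def)
qed

lemma digit_diff:
  assumes "2 \<le> p" "submask p n m"
  shows "digit p (m - n) e = digit p m e - digit p n e"
proof -
  define M where "M = m + n + e + 1"
  have "2 ^ (m + n + e + 1) \<le> p ^ M" unfolding M_def using assms(1) by (rule power_mono) simp
  moreover have "m + n + e + 1 < 2 ^ (m + n + e + 1)" by (rule less_exp)
  ultimately have MM: "m < p ^ M" "n < p ^ M" by linarith+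
  have "(\<Sum>e<M. (digit p m e - digit p n e) * p ^ e) + n = m"
  proof -
    have "(\<Sum>e<M. (digit p m e - digit p n e) * p ^ e) + (\<Sum>e<M. digit p n e * p ^ e)
        = (\<Sum>e<M. digit p m e * p ^ e)"
      using assms(2) by (simp add: submask_def flip: sum.distrib distrib_right)
    then show ?thesis using MM by (simp add: sum_digits)
  qed
  then have "m - n = (\<Sum>e<M. (digit p m e - digit p n e) * p ^ e)" by linarith
  then have "digit p (m - n) e = (if e < M then digit p m e - digit p n e else 0)"
    using digit_sum[of "\<lambda>e. digit p m e - digit p n e" p M e] assms(1) digit_less[of p m]
    by (simp add: less_imp_diff_less)
  then show ?thesis by (simp add: M_def)
qed

lemma submask_add_iff:
  assumes "2 \<le> p"
  shows "submask p b (a + b) \<longleftrightarrow> (\<forall>e. digit p a e + digit p b e < p)"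
proof
  assume s: "submask p b (a + b)"
  have "digit p a e = digit p (a + b) e - digit p b e" for e using digit_diff[OF assms s, of e] by simp
  moreover have "digit p b e \<le> digit p (a + b) e" for e using s by (simp add: submask_def)
  ultimately show "\<forall>e. digit p a e + digit p b e < p" using digit_less[of p "a + b"] assms by simp
next
  assume "\<forall>e. digit p a e + digit p b e < p"
  then show "submask p b (a + b)" using digit_add[OF assms] by (simp add: submask_def)
qed

definition cum :: "nat \<Rightarrow> (nat \<Rightarrow> nat) \<Rightarrow> nat \<Rightarrow> nat \<Rightarrow> nat" where
  "cum k b l E = (\<Sum>e<E. if e mod k = l then b e else 0)"

definition coin_exp :: "nat \<Rightarrow> (nat \<Rightarrow> nat) \<Rightarrow> nat \<Rightarrow> nat \<Rightarrow> nat" where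
  "coin_exp k b l s = (LEAST e. s < cum k b l (Suc e))"

lemma cum_mono: "E \<le> E' \<Longrightarrow> cum k b l E \<le> cum k b l E'"
  unfolding cum_def by (rule sum_mono2) auto

lemma cum_le: "(\<And>e. b e \<le> b' e) \<Longrightarrow> cum k b l E \<le> cum k b' l E"
  unfolding cum_def by (rule sum_mono) auto

lemma coin_exp_eqI:
  assumes "cum k b l e \<le> s" "s < cum k b l (Suc e)"
  shows "coin_exp k b l s = e"
  unfolding coin_exp_def
proof (rule Least_equality)
  fix y assume y: "s < cum k b l (Suc y)"
  show "e \<le> y"
  proof (rule ccontr)
    assume "\<not> e \<le> y"
    then have "cum k b l (Suc y) \<le> cum k b l e" by (intro cum_mono) auto
    then show False using y assms by simp
  qed
qed (rule assms)

lemma coin_exp: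
  assumes "s < cum k b l M"
  shows coin_exp_bound: "coin_exp k b l s < M"
    and coin_exp_upper: "s < cum k b l (Suc (coin_exp k b l s))"
    and coin_exp_lower: "cum k b l (coin_exp k b l s) \<le> s"
    and coin_exp_class: "coin_exp k b l s mod k = l"
proof -
  have "M \<noteq> 0"
  proof
    assume "M = 0"
    then show False using assms by (simp add: cum_def)
  qed
  then obtain M' where M': "M = Suc M'" by (cases M) auto
  show *: "s < cum k b l (Suc (coin_exp k b l s))"
    unfolding coin_exp_def by (rule LeastI[of _ M']) (use assms M' in auto)
  have "coin_exp k b l s \<le> M'" unfolding coin_exp_def by (rule Least_le) (use assms M' in auto)
  then show "coin_exp k b l s < M" using M' by simp
  show **: "cum k b l (coin_exp k b l s) \<le> s"
  proof (cases "coin_exp k b l s")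
    case (Suc e)
    then have "\<not> s < cum k b l (Suc e)" unfolding coin_exp_def by (intro not_less_Least) simp
    then show ?thesis using Suc by simp
  qed (simp add: cum_def)
  show "coin_exp k b l s mod k = l"
  proof (rule ccontr)
    assume "coin_exp k b l s mod k \<noteq> l"
    then have "cum k b l (Suc (coin_exp k b l s)) = cum k b l (coin_exp k b l s)" by (simp add: cum_def)
    then show False using * ** by simp
  qed
qed

lemma coin_exp_less_iff:
  assumes "s < cum k b l M"
  shows "coin_exp k b l s < E \<longleftrightarrow> s < cum k b l E"
proof
  assume "coin_exp k b l s < E"
  then have "cum k b l (Suc (coin_exp k b l s)) \<le> cum k b l E" by (intro cum_mono) auto
  then show "s < cum k b l E" using coin_exp_upper[OF assms] by simp
next
  assume "s < cum k b l E"
  then show "coin_exp k b l s < E" by (rule coin_exp_bound)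
qed

lemma sum_coins:
  "(\<Sum>s<cum k b l M. h (coin_exp k b l s)) = (\<Sum>e<M. if e mod k = l then b e * h e else (0::nat))"
proof (induction M)
  case (Suc M)
  have *: "coin_exp k b l s = M" if "cum k b l M \<le> s" "s < cum k b l (Suc M)" for s
    using that by (rule coin_exp_eqI)
  have "{..<cum k b l (Suc M)} = {..<cum k b l M} \<union> {cum k b l M..<cum k b l (Suc M)}"
    using cum_mono[of M "Suc M" k b l] by auto
  then have "(\<Sum>s<cum k b l (Suc M). h (coin_exp k b l s)) =
      (\<Sum>s<cum k b l M. h (coin_exp k b l s)) + (\<Sum>s=cum k b l M..<cum k b l (Suc M). h (coin_exp k b l s))"
    by (simp add: sum.union_disjoint[symmetric] ivl_disj_int)
  also have "(\<Sum>s=cum k b l M..<cum k b l (Suc M). h (coin_exp k b l s)) = (\<Sum>s=cum k b l M..<cum k b l (Suc M). h M)"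
    using * by (intro sum.cong) auto
  also have "\<dots> = (if M mod k = l then b M * h M else 0)" by (simp add: cum_def)
  finally show ?case using Suc by simp
qed (simp add: cum_def)

lemma sum_classes:
  fixes k M :: nat
  assumes "k > 0"
  shows "(\<Sum>l<k. \<Sum>e<M. if e mod k = l then f e else 0) = (\<Sum>e<M. f e :: 'b::comm_monoid_add)"
proof -
  have "(\<Sum>l<k. \<Sum>e<M. if e mod k = l then f e else 0) = (\<Sum>e<M. \<Sum>l<k. if e mod k = l then f e else 0)"
    by (rule sum.swap)
  also have "\<dots> = (\<Sum>e<M. f e)"
  proof (rule sum.cong)
    fix e
    have "(\<Sum>l<k. if e mod k = l then f e else 0) = (\<Sum>l\<in>{e mod k}. f e)"
      by (rule sum.mono_neutral_cong_right) (use assms in auto)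
    then show "(\<Sum>l<k. if e mod k = l then f e else 0) = f e" by simp
  qed simp
  finally show ?thesis .
qed

lemma sum_all_coins:
  "k > 0 \<Longrightarrow> (\<Sum>l<k. \<Sum>s<cum k b l M. h (coin_exp k b l s)) = (\<Sum>e<M. b e * h e :: nat)"
  unfolding sum_coins by (rule sum_classes)

lemma power_mod_cong:
  fixes p :: nat
  assumes "q = p ^ k" "p > 0"
  shows "[p ^ e = p ^ (e mod k)] (mod (q - 1))"
proof -
  have "[1 + (q - 1) = 1] (mod (q - 1))" by (simp only: cong_def mod_add_self2)
  moreover have "1 + (q - 1) = q" using assms by simp
  ultimately have "[q = 1] (mod (q - 1))" by simp
  then have "[q ^ (e div k) * p ^ (e mod k) = 1 ^ (e div k) * p ^ (e mod k)] (mod (q - 1))"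
    by (intro cong_mult cong_pow) auto
  moreover have "q ^ (e div k) * p ^ (e mod k) = p ^ e"
    using assms by (simp flip: power_mult power_add)
  ultimately show ?thesis by simp
qed

lemma class_sum_cong:
  assumes "q = p ^ k" "p > 0" "k > 0"
  shows "[(\<Sum>l<k. cum k b l M * p ^ l) = (\<Sum>e<M. b e * p ^ e)] (mod (q - 1))"
proof -
  have "(\<Sum>l<k. cum k b l M * p ^ l) = (\<Sum>l<k. \<Sum>e<M. if e mod k = l then b e * p ^ (e mod k) else 0)"
    unfolding cum_def sum_distrib_right by (intro sum.cong) auto
  also have "\<dots> = (\<Sum>e<M. b e * p ^ (e mod k))" by (rule sum_classes[OF assms(3)])
  also have "[\<dots> = (\<Sum>e<M. b e * p ^ e)] (mod (q - 1))"
    using power_mod_cong[OF assms(1,2)] by (intro cong_sum cong_mult) (auto intro: cong_sym)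
  finally show ?thesis .
qed

lemma tail_sum_Suc: "i < length ms \<Longrightarrow> tail_sum ms i = ms ! i + tail_sum ms (Suc i)"
  by (simp add: tail_sum_def flip: Cons_nth_drop_Suc)

lemma tail_sum_beyond: "length ms \<le> i \<Longrightarrow> tail_sum ms i = 0"
  by (simp add: tail_sum_def)

lemma tail_sum_0: "tail_sum ms 0 = sum_list ms"
  by (simp add: tail_sum_def)

lemma tail_sum_Cons: "tail_sum (a # ms) (Suc i) = tail_sum ms i"
  by (simp add: tail_sum_def)

lemma weight_tail_sums: "weight ms = (\<Sum>i<length ms. tail_sum ms (Suc i))"
proof (induction ms)
  case (Cons a ms)
  have "weight (a # ms) = (\<Sum>i<length ms. Suc i * ms ! i)"
    by (simp add: weight_def sum.lessThan_Suc_shift del: sum.lessThan_Suc)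
  also have "\<dots> = sum_list ms + weight ms"
    by (simp add: weight_def sum.distrib sum_list_sum_nth lessThan_atLeast0)
  also have "\<dots> = tail_sum ms 0 + (\<Sum>i<length ms. tail_sum ms (Suc i))"
    by (simp add: Cons tail_sum_0)
  also have "\<dots> = (\<Sum>i<Suc (length ms). tail_sum ms i)"
    by (simp add: sum.lessThan_Suc_shift del: sum.lessThan_Suc)
  finally show ?case by (simp add: tail_sum_Cons)
qed (simp add: weight_def)

lemma digit_sum_list:
  assumes "2 \<le> p" "no_carry p ms"
  shows "digit p (sum_list ms) e = (\<Sum>k\<leftarrow>ms. digit p k e)"
  using assms(2)
proof (induction ms arbitrary: e)
  case (Cons a ms)
  have lt: "digit p a e + (\<Sum>k\<leftarrow>ms. digit p k e) < p" for e
    using Cons.prems by (simp add: no_carry_def)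
  then have "no_carry p ms" unfolding no_carry_def by (meson le_add2 le_less_trans)
  then have "digit p (sum_list ms) e = (\<Sum>k\<leftarrow>ms. digit p k e)" for e by (rule Cons.IH)
  then show ?case using digit_add[OF assms(1), of a "sum_list ms"] lt by simp
qed simp

lemma no_carry_iff:
  assumes "2 \<le> p"
  shows "no_carry p ms \<longleftrightarrow> (\<forall>i<length ms. submask p (tail_sum ms (Suc i)) (tail_sum ms i))"
proof (induction ms)
  case Nil
  then show ?case using assms by (simp add: no_carry_def)
next
  case (Cons a ms)
  have "no_carry p (a # ms) \<longleftrightarrow> no_carry p ms \<and> submask p (sum_list ms) (a + sum_list ms)"
  proof
    assume nc: "no_carry p (a # ms)"
    have lt: "digit p a e + (\<Sum>k\<leftarrow>ms. digit p k e) < p" for e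
      using nc by (simp add: no_carry_def)
    then have "no_carry p ms" unfolding no_carry_def by (meson le_add2 le_less_trans)
    then show "no_carry p ms \<and> submask p (sum_list ms) (a + sum_list ms)"
      using lt digit_sum_list[OF assms] by (simp add: submask_add_iff[OF assms])
  next
    assume "no_carry p ms \<and> submask p (sum_list ms) (a + sum_list ms)"
    then show "no_carry p (a # ms)"
      using digit_sum_list[OF assms, of ms] by (simp add: submask_add_iff[OF assms] no_carry_def)
  qed
  also have "\<dots> \<longleftrightarrow> (\<forall>i<length (a # ms). submask p (tail_sum (a # ms) (Suc i)) (tail_sum (a # ms) i))"
    unfolding Cons by (auto simp: All_less_Suc2 tail_sum_Cons tail_sum_0)
  finally show ?case .
qed

lemma tail_sum_telescope:
  assumes "\<And>i. i < K \<Longrightarrow> N (Suc i) \<le> N i" "j \<le> K"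
  shows "tail_sum (map (\<lambda>i. N i - N (Suc i)) [0..<K]) j = N j - (N K :: nat)"
  using assms(2)
proof (induction rule: inc_induct)
  case (step n)
  have dec: "N K \<le> N i" if "i \<le> K" for i
    using that
  proof (induction rule: inc_induct)
    case (step n)
    then show ?case using assms(1)[of n] by simp
  qed simp
  have "tail_sum (map (\<lambda>i. N i - N (Suc i)) [0..<K]) n = (N n - N (Suc n)) + (N (Suc n) - N K)"
    using step by (subst tail_sum_Suc) auto
  then show ?case using assms(1)[of n] dec[of "Suc n"] step by simp
qed (simp add: tail_sum_beyond)

lemma tail_sum_inj:
  assumes "length ms = length ms'" "\<And>i. tail_sum ms i = tail_sum ms' i"
  shows "ms = ms'"
proof (rule nth_equalityI[OF assms(1)])
  fix i assume "i < length ms"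
  then show "ms ! i = ms' ! i"
    using tail_sum_Suc[of i ms] tail_sum_Suc[of i ms'] assms by simp
qed

lemma sum_mset_counts:
  fixes N :: "nat multiset"
  assumes "finite A" "set_mset N \<subseteq> A"
  shows "sum_mset N = (\<Sum>x\<in>A. count N x * x)"
  using assms(2)
proof (induction N)
  case (add x N)
  have "(\<Sum>y\<in>A. count (add_mset x N) y * y) = (\<Sum>y\<in>A. count N y * y + (if y = x then x else 0))"
    by (rule sum.cong) auto
  also have "\<dots> = sum_mset N + x" using add assms(1) by (simp add: sum.distrib)
  finally show ?case by simp
qed simp

lemma sum_mset_sum: "sum_mset (\<Sum>x\<in>A. f x) = (\<Sum>x\<in>A. sum_mset (f x))"
  by (induction A rule: infinite_finite_induct) simp_all

lemma p_power_sums_eq: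
  assumes p: "2 \<le> p"
  shows "p_power_sums p n = {i. submask p i n}"
proof -
  have inj: "p ^ e = p ^ e' \<longleftrightarrow> e = e'" for e e' using p by simp
  have cnt: "count (\<Sum>e\<le>n. replicate_mset (f e) (p ^ e)) (p ^ e) = (if e \<le> n then f e else 0)" for f e
    by (simp add: count_sum inj)
  have cnt0: "count (\<Sum>e\<le>n. replicate_mset (f e) (p ^ e)) x = 0" if "x \<notin> range ((^) p)" for f x
    using that by (auto simp: count_sum)
  have n_less: "i < p ^ Suc n" if "i \<le> n" for i
    using less_power_add[OF p, of i "Suc n - i"] that by simp
  show ?thesis
  proof (intro equalityI subsetI)
    fix i assume "i \<in> p_power_sums p n"
    then obtain N where N: "N \<subseteq># p_powers p n" "i = sum_mset N" by (auto simp: p_power_sums_def)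
    have le: "count N x \<le> count (p_powers p n) x" for x using N(1) by (simp add: mset_subset_eq_count)
    have d0: "digit p n e = 0" if "n < e" for e using digit_eq_0[OF n_less[of n], of e] that p by simp
    have le': "count N (p ^ e) \<le> digit p n e" for e
      using le[of "p ^ e"] by (auto simp: p_powers_def cnt split: if_splits)
    have "set_mset N \<subseteq> (^) p ` {..n}"
    proof
      fix x assume "x \<in># N"
      then have c: "count (p_powers p n) x \<noteq> 0" using mset_subset_eqD[OF N(1)] by simp
      have "x \<in> range ((^) p)"
      proof (rule ccontr)
        assume "x \<notin> range ((^) p)"
        then show False using c cnt0[of x "digit p n"] by (simp add: p_powers_def)
      qed
      then obtain e where "x = p ^ e" by blast
      then show "x \<in> (^) p ` {..n}" using c by (auto simp: p_powers_def cnt split: if_splits)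
    qed
    then have "i = (\<Sum>x\<in>(^) p ` {..n}. count N x * x)" using N(2) sum_mset_counts by simp
    also have "\<dots> = (\<Sum>e<Suc n. count N (p ^ e) * p ^ e)"
      using inj by (simp add: sum.reindex inj_on_def lessThan_Suc_atMost)
    finally have i: "i = (\<Sum>e<Suc n. count N (p ^ e) * p ^ e)" .
    have "count N (p ^ e) < p" for e using le'[of e] digit_less[of p n e] p by simp
    then show "i \<in> {i. submask p i n}"
      using digit_sum[of "\<lambda>e. count N (p ^ e)" p "Suc n"] le' unfolding i submask_def by auto
  next
    fix i assume i: "i \<in> {i. submask p i n}"
    define N where "N = (\<Sum>e\<le>n. replicate_mset (digit p i e) (p ^ e))"
    have "N \<subseteq># p_powers p n"
    proof (rule mset_subset_eqI)
      fix x
      show "count N x \<le> count (p_powers p n) x"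
      proof (cases "x \<in> range ((^) p)")
        case True
        then show ?thesis using i by (auto simp: N_def p_powers_def cnt submask_def)
      qed (simp add: N_def cnt0)
    qed
    moreover have "sum_mset N = i"
    proof -
      have "sum_mset N = (\<Sum>e<Suc n. digit p i e * p ^ e)"
        by (simp add: N_def sum_mset_sum lessThan_Suc_atMost)
      also have "\<dots> = i" using i submask_le[OF p] n_less by (intro sum_digits) auto
      finally show ?thesis .
    qed
    ultimately show "i \<in> p_power_sums p n" by (auto simp: p_power_sums_def)
  qed
qed

lemma cong_residue_iff:
  assumes "int r = z mod int Q"
  shows "[n = r] (mod Q) \<longleftrightarrow> int Q dvd z - int n"
proof -
  have "[n = r] (mod Q) \<longleftrightarrow> [int n = int r] (mod int Q)" by (simp add: cong_int_iff)
  also have "\<dots> \<longleftrightarrow> z mod int Q = int n mod int Q" using assms by (auto simp: cong_def)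
  finally show ?thesis by (simp add: mod_eq_dvd_iff)
qed

lemma slack_class_sum:
  fixes x :: "nat \<Rightarrow> int"
  assumes "k > 0"
  shows "(\<Sum>l<k. ((if l = 0 then r else 0) + P * x l - x (if l = 0 then k - 1 else l - 1)) * P ^ l)
    = r + x (k - 1) * (P ^ k - 1)"
proof -
  obtain k' where k: "k = Suc k'" using assms by (cases k) auto
  have "(\<Sum>l<Suc n. ((if l = 0 then r else 0) + P * x l - x (if l = 0 then k - 1 else l - 1)) * P ^ l)
      = r + x n * P ^ Suc n - x (k - 1)" for n
    by (induction n) (simp_all add: algebra_simps)
  from this[of k'] show ?thesis using k by (simp add: algebra_simps)
qed

lemma slack_solve:
  fixes v :: "nat \<Rightarrow> int"
  assumes "k > 0" and "(P ^ k - 1) dvd (\<Sum>l<k. v l * P ^ l) - r"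
  shows "\<exists>x. \<forall>l<k. (if l = 0 then r else 0) + P * x l - x (if l = 0 then k - 1 else l - 1) = v l"
proof -
  obtain K where K: "(\<Sum>l<k. v l * P ^ l) - r = (P ^ k - 1) * K" using assms by (auto elim: dvdE)
  define x where "x l = P ^ (k - 1 - l) * K - (\<Sum>i\<in>{Suc l..<k}. v i * P ^ (i - l - 1))" for l
  have step: "P * x l = P ^ (k - l) * K - (\<Sum>i\<in>{Suc l..<k}. v i * P ^ (i - l))" if "l < k" for l
  proof -
    have e: "k - l = Suc (k - 1 - l)" using that by simp
    have "(\<Sum>i\<in>{Suc l..<k}. v i * P ^ (i - l)) = P * (\<Sum>i\<in>{Suc l..<k}. v i * P ^ (i - l - 1))"
      unfolding sum_distrib_left
    proof (rule sum.cong)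
      fix i assume "i \<in> {Suc l..<k}"
      then have "i - l = Suc (i - l - 1)" by auto
      then show "v i * P ^ (i - l) = P * (v i * P ^ (i - l - 1))" by (metis mult.left_commute power_Suc)
    qed simp
    then show ?thesis unfolding x_def e by (simp add: algebra_simps)
  qed
  have "(if l = 0 then r else 0) + P * x l - x (if l = 0 then k - 1 else l - 1) = v l" if l: "l < k" for l
  proof (cases l)
    case 0
    have "x (k - 1) = K" using assms by (simp add: x_def)
    moreover have "(\<Sum>l<k. v l * P ^ l) = v 0 + (\<Sum>i\<in>{Suc 0..<k}. v i * P ^ i)"
      using assms by (simp add: lessThan_atLeast0 sum.atLeast_Suc_lessThan)
    ultimately show ?thesis using step[OF l] K 0 by (simp add: algebra_simps)
  next
    case (Suc l')
    have "x l' = P ^ (k - l) * K - (\<Sum>i\<in>{l..<k}. v i * P ^ (i - l))"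
      unfolding x_def Suc by (simp add: algebra_simps)
    also have "(\<Sum>i\<in>{l..<k}. v i * P ^ (i - l)) = v l + (\<Sum>i\<in>{Suc l..<k}. v i * P ^ (i - l))"
      using l by (simp add: sum.atLeast_Suc_lessThan)
    finally show ?thesis using step[OF l] Suc by simp
  qed
  then show ?thesis by blast
qed

locale digit_system =
  fixes p k m r :: nat
  assumes p_ge: "2 \<le> p" and k_pos: "0 < k"
begin

definition coin :: "nat \<Rightarrow> nat \<Rightarrow> int" where
  "coin l s = int (p ^ coin_exp k (digit p m) l s)"

definition room :: "nat \<Rightarrow> nat" where
  "room l = cum k (digit p m) l m"

lemma m_less: "n \<le> m \<Longrightarrow> n < p ^ m"
  using less_power_add[OF p_ge, of n "m - n"] by simp

lemma coin_le_iff: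
  "coin l s \<le> int (p ^ E) \<longleftrightarrow> coin_exp k (digit p m) l s \<le> E"
  "coin l s < int (p ^ E) \<longleftrightarrow> coin_exp k (digit p m) l s < E"
  using p_ge by (simp_all add: coin_def)

sublocale coin_system "{..<k}" "\<lambda>l. if l = 0 then k - 1 else l - 1" "int p"
  "\<lambda>l. int (room l)" coin "\<lambda>l. if l = 0 then int r else 0"
proof
  show "{..<k} \<noteq> {}" using k_pos by auto
  show "S = {..<k}" if "S \<subseteq> {..<k}" "S \<noteq> {}" and cl: "\<And>l. l \<in> S \<Longrightarrow> (if l = 0 then k - 1 else l - 1) \<in> S" for S
  proof -
    have down: "y \<in> S" if "x \<in> S" "y \<le> x" for x y
      using that(2,1)
    proof (induction rule: inc_induct)
      case (step n)
      then show ?case using cl[of "Suc n"] by simp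
    qed
    obtain x where "x \<in> S" using \<open>S \<noteq> {}\<close> by blast
    then have "0 \<in> S" using down[of x 0] by simp
    then have "k - 1 \<in> S" using cl[of 0] by simp
    then have "{..<k} \<subseteq> S" using down[of "k - 1"] by auto
    then show ?thesis using that by blast
  qed
  show "2 \<le> int p" using p_ge by simp
  show "0 \<le> coin l s" for l s by (simp add: coin_def)
  show "coin l s \<le> coin l s'" if "s \<le> s'" "int s' < int (room l)" for l s s'
  proof -
    have s': "s' < cum k (digit p m) l m" using that by (simp add: room_def)
    then have "s < cum k (digit p m) l (Suc (coin_exp k (digit p m) l s'))"
      using coin_exp_upper[OF s'] that by simp
    then have "coin_exp k (digit p m) l s < Suc (coin_exp k (digit p m) l s')" by (rule coin_exp_bound)
    then show ?thesis unfolding coin_def[of l s'] coin_le_iff by simp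
  qed
  show "coin l s < coin l s'" if "int s + int p - 1 \<le> int s'" "int s' < int (room l)" for l s s'
  proof -
    have s': "s' < cum k (digit p m) l m" using that by (simp add: room_def)
    define e where "e = coin_exp k (digit p m) l s'"
    have "s' < cum k (digit p m) l (Suc e)" unfolding e_def using coin_exp_upper[OF s'] .
    also have "\<dots> \<le> cum k (digit p m) l e + digit p m e" by (simp add: cum_def)
    finally have "s < cum k (digit p m) l e" using that digit_less[of p m e] p_ge by simp
    then have "coin_exp k (digit p m) l s < e" by (rule coin_exp_bound)
    then show ?thesis unfolding coin_def[of l s'] coin_le_iff by (simp add: e_def)
  qed
  show "(\<Sum>l'\<in>{..<k}. \<Sum>s' | int s' < int (room l') \<and> coin l' s' < coin l s. coin l' s') < coin l s"
    if "int s < int (room l)" for l s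
  proof -
    define E where "E = coin_exp k (digit p m) l s"
    have Em: "E < m" unfolding E_def using that by (intro coin_exp_bound[of _ _ _ _ m]) (simp add: room_def)
    have "{s'. int s' < int (room l') \<and> coin l' s' < coin l s} = {..<cum k (digit p m) l' E}" for l'
      using coin_exp_less_iff[of _ k "digit p m" l' m E] cum_mono[of E m k "digit p m" l'] Em
      unfolding coin_def[of l s] coin_le_iff room_def E_def[symmetric] by auto
    then have "(\<Sum>l'\<in>{..<k}. \<Sum>s' | int s' < int (room l') \<and> coin l' s' < coin l s. coin l' s')
        = int (\<Sum>l'<k. \<Sum>s'<cum k (digit p m) l' E. p ^ coin_exp k (digit p m) l' s')"
      by (simp add: coin_def)
    also have "\<dots> = int (m mod p ^ E)"
      using sum_all_coins[OF k_pos, where b = "digit p m" and M = E and h = "\<lambda>e. p ^ e"] by (simp add: sum_digits_mod)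
    also have "\<dots> < int (p ^ E)" using p_ge by simp
    finally show ?thesis by (simp add: coin_def E_def)
  qed
  show "l = l'" if "int s < int (room l)" "int s' < int (room l')" "coin l s = coin l' s'" for l l' s s'
  proof -
    have "coin_exp k (digit p m) l s = coin_exp k (digit p m) l' s'"
      using that p_ge by (simp add: coin_def)
    then show ?thesis
      using coin_exp_class[of s k "digit p m" l m] coin_exp_class[of s' k "digit p m" l' m] that
      by (simp add: room_def)
  qed
qed (use k_pos in auto)

abbreviation vec :: "(nat \<Rightarrow> int) \<Rightarrow> nat \<Rightarrow> int" where
  "vec x \<equiv> slack (\<lambda>l. if l = 0 then int r else 0) x"

lemma vec_exists:
  assumes "submask p n m" "[n = r] (mod (p ^ k - 1))"
  shows "\<exists>x. \<forall>l<k. vec x l = int (cum k (digit p n) l m)"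
proof -
  have nm: "n \<le> m" using submask_le[OF p_ge assms(1)] .
  have "[(\<Sum>l<k. cum k (digit p n) l m * p ^ l) = r] (mod (p ^ k - 1))"
    using class_sum_cong[OF refl _ k_pos, of p "digit p n" m] p_ge sum_digits[OF m_less[OF nm]] assms(2)
    by (auto intro: cong_trans)
  then have "[int (\<Sum>l<k. cum k (digit p n) l m * p ^ l) = int r] (mod (int (p ^ k - 1)))"
    by (simp add: cong_int_iff del: of_nat_sum)
  then have "(int p ^ k - 1) dvd (\<Sum>l<k. int (cum k (digit p n) l m) * int p ^ l) - int r"
    using p_ge by (simp add: cong_iff_dvd_diff of_nat_diff)
  from slack_solve[OF k_pos this] show ?thesis by (simp add: slack_def)
qed

lemma vec_feas:
  assumes "submask p n m" "\<And>l. l < k \<Longrightarrow> vec x l = int (cum k (digit p n) l m)"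
  shows "feas x" and "cost1 x \<le> int n"
proof -
  have le: "digit p n e \<le> digit p m e" for e using assms(1) by (simp add: submask_def)
  have cle: "cum k (digit p n) l E \<le> cum k (digit p m) l E" for l E by (rule cum_le) (rule le)
  show "feas x" unfolding feas_def in_range_def using assms(2) cle by (auto simp: room_def)
  have "cost1 x = int (\<Sum>l<k. \<Sum>s<cum k (digit p n) l m. p ^ coin_exp k (digit p m) l s)"
    using assms(2) by (simp add: cost1_def price_def phi_def coin_def)
  also have "\<dots> \<le> int (\<Sum>l<k. \<Sum>s<cum k (digit p n) l m. p ^ coin_exp k (digit p n) l s)"
    unfolding of_nat_le_iff
  proof (intro sum_mono)
    fix l s assume "s \<in> {..<cum k (digit p n) l m}"
    then have "s < cum k (digit p n) l (Suc (coin_exp k (digit p n) l s))"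
      by (intro coin_exp_upper) auto
    also have "\<dots> \<le> cum k (digit p m) l (Suc (coin_exp k (digit p n) l s))" by (rule cle)
    finally have "coin_exp k (digit p m) l s \<le> coin_exp k (digit p n) l s"
      unfolding coin_exp_def[of k "digit p m"] by (rule Least_le)
    then show "p ^ coin_exp k (digit p m) l s \<le> p ^ coin_exp k (digit p n) l s"
      using p_ge by (intro power_increasing) auto
  qed
  also have "\<dots> = int n"
    unfolding sum_all_coins[OF k_pos] using sum_digits[OF m_less[OF submask_le[OF p_ge assms(1)]]] by simp
  finally show "cost1 x \<le> int n" .
qed

definition take_digit :: "(nat \<Rightarrow> int) \<Rightarrow> nat \<Rightarrow> nat" where
  "take_digit x e = min (nat (vec x (e mod k))) (cum k (digit p m) (e mod k) (Suc e))
     - min (nat (vec x (e mod k))) (cum k (digit p m) (e mod k) e)"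

definition mask_of :: "(nat \<Rightarrow> int) \<Rightarrow> nat" where
  "mask_of x = (\<Sum>e<m. take_digit x e * p ^ e)"

lemma take_digit_le: "take_digit x e \<le> digit p m e"
  by (auto simp: take_digit_def cum_def)

lemma digit_mask_of: "digit p (mask_of x) e = (if e < m then take_digit x e else 0)"
  unfolding mask_of_def
  using take_digit_le digit_less[of p m] p_ge by (intro digit_sum) (meson le_less_trans less_le_trans zero_less_numeral)

lemma submask_mask_of: "submask p (mask_of x) m"
  using take_digit_le by (simp add: submask_def digit_mask_of)

lemma cum_take_digit: "cum k (take_digit x) l E = min (nat (vec x l)) (cum k (digit p m) l E)"
proof (induction E)
  case (Suc E)
  have "cum k (digit p m) l E \<le> cum k (digit p m) l (Suc E)" by (rule cum_mono) simp
  moreover have "cum k b l (Suc E) = cum k b l E + (if E mod k = l then b E else 0)" for b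
    by (simp add: cum_def)
  ultimately show ?case using Suc by (auto simp: take_digit_def)
qed (simp add: cum_def)

lemma cum_digit_mask_of: "cum k (digit p (mask_of x)) l m = cum k (take_digit x) l m"
  unfolding cum_def by (intro sum.cong) (auto simp: digit_mask_of)

lemma mask_of:
  assumes "feas x"
  shows vec_mask_of: "l < k \<Longrightarrow> int (cum k (digit p (mask_of x)) l m) = vec x l"
    and mask_of_cost: "int (mask_of x) = cost1 x"
    and mask_of_cong: "[mask_of x = r] (mod (p ^ k - 1))"
proof -
  have rng: "0 \<le> vec x l \<and> vec x l \<le> int (room l)" if "l < k" for l
    using assms that by (auto simp: feas_def in_range_def)
  have ct: "cum k (take_digit x) l m = nat (vec x l)" if "l < k" for l
    using rng[OF that] by (auto simp: cum_take_digit room_def min_def)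
  then show v: "int (cum k (digit p (mask_of x)) l m) = vec x l" if "l < k" for l
    using rng[OF that] that by (simp add: cum_digit_mask_of)
  have ce: "coin_exp k (take_digit x) l s = coin_exp k (digit p m) l s" if "s < nat (vec x l)" for l s
    unfolding coin_exp_def cum_take_digit using that by simp
  have "mask_of x = (\<Sum>l<k. \<Sum>s<cum k (take_digit x) l m. p ^ coin_exp k (take_digit x) l s)"
    unfolding mask_of_def sum_all_coins[OF k_pos] ..
  also have "\<dots> = (\<Sum>l<k. \<Sum>s<nat (vec x l). p ^ coin_exp k (digit p m) l s)"
    by (intro sum.cong) (use ct ce in auto)
  finally show "int (mask_of x) = cost1 x" by (simp add: cost1_def price_def phi_def coin_def)
  have "(\<Sum>l<k. int (cum k (digit p (mask_of x)) l m) * int p ^ l) = (\<Sum>l<k. vec x l * int p ^ l)"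
    using v by (intro sum.cong) auto
  also have "\<dots> = int r + x (k - 1) * (int p ^ k - 1)"
    unfolding slack_def by (rule slack_class_sum[OF k_pos])
  finally have "int (\<Sum>l<k. cum k (digit p (mask_of x)) l m * p ^ l) = int r + x (k - 1) * (int p ^ k - 1)"
    by simp
  then have "[int (\<Sum>l<k. cum k (digit p (mask_of x)) l m * p ^ l) = int r] (mod (int p ^ k - 1))"
    by (simp add: cong_iff_dvd_diff)
  moreover have "int p ^ k - 1 = int (p ^ k - 1)" using p_ge by (simp add: of_nat_diff)
  ultimately have "[(\<Sum>l<k. cum k (digit p (mask_of x)) l m * p ^ l) = r] (mod (p ^ k - 1))"
    by (simp add: cong_int_iff del: of_nat_sum)
  moreover have "[(\<Sum>l<k. cum k (digit p (mask_of x)) l m * p ^ l) = mask_of x] (mod (p ^ k - 1))"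
    using class_sum_cong[OF refl _ k_pos, of p "digit p (mask_of x)" m] p_ge
      sum_digits[OF m_less[OF submask_le[OF p_ge submask_mask_of]]] by simp
  ultimately show "[mask_of x = r] (mod (p ^ k - 1))" by (metis cong_sym cong_trans)
qed

lemma mask_of_mono:
  assumes "\<And>l. l < k \<Longrightarrow> vec y l \<le> vec x l"
  shows "submask p (mask_of y) (mask_of x)"
proof -
  have "take_digit y e \<le> take_digit x e" for e
  proof -
    have "nat (vec y (e mod k)) \<le> nat (vec x (e mod k))" using assms k_pos by (intro nat_mono) auto
    moreover have "cum k (digit p m) (e mod k) e \<le> cum k (digit p m) (e mod k) (Suc e)" by (rule cum_mono) simp
    moreover have "min a C' - min a C \<le> min b C' - min b C" if "a \<le> b" "C \<le> C'" for a b C C' :: nat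
      using that by (auto simp: min_def)
    ultimately show ?thesis unfolding take_digit_def by blast
  qed
  then show ?thesis by (simp add: submask_def digit_mask_of)
qed

lemma far_below_vec:
  assumes "submask p n m" "submask p n' n" "n' \<noteq> n"
    and x: "\<And>l. l < k \<Longrightarrow> vec x l = int (cum k (digit p n) l m)"
    and y: "\<And>l. l < k \<Longrightarrow> vec y l = int (cum k (digit p n') l m)"
  shows "far_below y x"
proof -
  have le: "digit p n' e \<le> digit p n e" for e using assms(2) by (simp add: submask_def)
  have lem: "n \<le> m" "n' \<le> m" using submask_le[OF p_ge] assms(1,2) submask_trans by blast+
  define D where "D l = x l - y l" for l
  have D: "int p * D l - D (if l = 0 then k - 1 else l - 1)
      = int (cum k (digit p n) l m) - int (cum k (digit p n') l m)" if "l < k" for l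
    using x[OF that] y[OF that] by (simp add: slack_def D_def algebra_simps)
  have nn: "0 \<le> int p * D l - D (if l = 0 then k - 1 else l - 1)" if "l \<in> {..<k}" for l
    using D[of l] that cum_le[of "digit p n'" "digit p n" k l m] le by simp
  have "\<exists>l0<k. D l0 \<noteq> 0"
  proof (rule ccontr)
    assume all0: "\<not> ?thesis"
    then have eq: "cum k (digit p n) l m = cum k (digit p n') l m" if "l < k" for l
    proof -
      have "D l = 0" "D (if l = 0 then k - 1 else l - 1) = 0" using all0 that by auto
      then show ?thesis using D[OF that] by simp
    qed
    have "(\<Sum>e<m. digit p n e * 1) = (\<Sum>e<m. digit p n' e * 1)"
      unfolding sum_all_coins[OF k_pos, symmetric] using eq by simp
    then have "digit p n' e = digit p n e" if "e < m" for e
      using sum_mono_inv[of "digit p n'" "{..<m}" "digit p n" e] le that by simp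
    then have "(\<Sum>e<m. digit p n' e * p ^ e) = (\<Sum>e<m. digit p n e * p ^ e)" by simp
    then show False using sum_digits[OF m_less[OF lem(1)]] sum_digits[OF m_less[OF lem(2)]] assms(3) by simp
  qed
  then obtain l0 where "l0 < k" "D l0 \<noteq> 0" by blast
  then have "1 \<le> D l" if "l < k" for l
    using cyclic_pos[of D l0 l] nn that by auto
  then show ?thesis by (force simp: far_below_def D_def)
qed

definition nchain :: "nat \<Rightarrow> (nat \<Rightarrow> nat) \<Rightarrow> bool" where
  "nchain d n \<longleftrightarrow> submask p (n 0) m \<and> (\<forall>i<d. [n i = r] (mod (p ^ k - 1))) \<and>
     (\<forall>i. Suc i < d \<longrightarrow> submask p (n (Suc i)) (n i) \<and> n (Suc i) \<noteq> n i)"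

lemma nchain_submask: "nchain d n \<Longrightarrow> i < d \<Longrightarrow> submask p (n i) m"
proof (induction i)
  case (Suc i)
  then have "submask p (n (Suc i)) (n i)" "submask p (n i) m" by (simp_all add: nchain_def)
  then show ?case by (rule submask_trans)
qed (simp add: nchain_def)

lemma nchain_vec:
  assumes "nchain d n"
  shows "\<exists>x. \<forall>i<d. \<forall>l<k. vec (x i) l = int (cum k (digit p (n i)) l m)"
proof -
  have "\<exists>x. i < d \<longrightarrow> (\<forall>l<k. vec x l = int (cum k (digit p (n i)) l m))" for i
    using vec_exists[OF nchain_submask[OF assms], of i] assms by (auto simp: nchain_def)
  then show ?thesis by metis
qed

lemma nchain_chain:
  assumes n: "nchain d n" and x: "\<And>i l. i < d \<Longrightarrow> l < k \<Longrightarrow> vec (x i) l = int (cum k (digit p (n i)) l m)"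
    and t: "\<And>l. x 0 l \<le> t l"
  shows "chain d t x"
  unfolding chain_def
proof (intro conjI allI impI)
  show "feas (x i)" if "i < d" for i
    using vec_feas(1)[OF nchain_submask[OF n that]] x that by blast
  show "below (x 0) t" using t by (simp add: below_def)
  show "far_below (x (Suc i)) (x i)" if "Suc i < d" for i
    by (rule far_below_vec[OF nchain_submask[OF n, of i]]) (use n x that in \<open>auto simp: nchain_def\<close>)
qed

lemma chain_nchain:
  assumes "optimal d t c" "d > 0"
  shows "nchain d (\<lambda>i. mask_of (c i))"
  unfolding nchain_def
proof (intro conjI allI impI)
  have ch: "chain d t c" using assms by (simp add: optimal_def)
  have f: "feas (c i)" if "i < d" for i using ch that by (simp add: chain_def)
  show "submask p (mask_of (c 0)) m" by (rule submask_mask_of)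
  show "[mask_of (c i) = r] (mod (p ^ k - 1))" if "i < d" for i
    by (rule mask_of_cong[OF f[OF that]])
  fix i assume i: "Suc i < d"
  show "submask p (mask_of (c (Suc i))) (mask_of (c i))"
    by (rule mask_of_mono) (use optimal_slack_antimono[OF assms(1) i] in auto)
  show "mask_of (c (Suc i)) \<noteq> mask_of (c i)"
  proof
    assume "mask_of (c (Suc i)) = mask_of (c i)"
    then have "cost1 (c (Suc i)) = cost1 (c i)" using mask_of_cost[OF f[OF i]] mask_of_cost[OF f[OF Suc_lessD[OF i]]] by simp
    then have "c (Suc i) 0 = c i 0" using cost1_inj(2)[OF f[OF i] f[OF Suc_lessD[OF i]], of 0] k_pos by simp
    moreover have "c (Suc i) 0 < c i 0" using ch i k_pos by (auto simp: chain_def far_below_def)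
    ultimately show False by simp
  qed
qed

lemma nchain_optimal:
  assumes n: "nchain d n" and d: "d > 0"
    and opt: "\<And>n'. nchain d n' \<Longrightarrow> (\<Sum>i<d. n i) \<le> (\<Sum>i<d. n' i)"
    and x: "\<And>i l. i < d \<Longrightarrow> l < k \<Longrightarrow> vec (x i) l = int (cum k (digit p (n i)) l m)"
    and t: "\<And>l. x 0 l \<le> t l"
  shows "optimal d t x" and "\<And>i. i < d \<Longrightarrow> cost1 (x i) = int (n i)"
proof -
  have ch: "chain d t x" by (rule nchain_chain[OF n x t])
  obtain c where c: "optimal d t c" using optimal_exists[OF ch] by blast
  have "(\<Sum>i<d. n i) \<le> (\<Sum>i<d. mask_of (c i))" by (rule opt) (rule chain_nchain[OF c d])
  also have "int \<dots> = cost d c"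
    using c by (auto simp: cost_def optimal_def chain_def mask_of_cost intro!: sum.cong)
  finally have 1: "int (\<Sum>i<d. n i) \<le> cost d c" by simp
  have le: "cost1 (x i) \<le> int (n i)" if "i < d" for i
    by (rule vec_feas(2)[OF nchain_submask[OF n that]]) (use x that in auto)
  then have 2: "cost d x \<le> int (\<Sum>i<d. n i)" by (auto simp: cost_def intro!: sum_mono)
  show "optimal d t x" using c 1 2 ch by (fastforce simp: optimal_def)
  have "cost d c \<le> cost d x" using c ch by (auto simp: optimal_def)
  then have "(\<Sum>i<d. cost1 (x i)) = (\<Sum>i<d. int (n i))" using 1 2 by (simp add: cost_def)
  then show "cost1 (x i) = int (n i)" if "i < d" for i
    using sum_mono_inv[of "\<lambda>i. cost1 (x i)" "{..<d}" "\<lambda>i. int (n i)" i] le that by simp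
qed

theorem nchain_first_least:
  assumes n: "nchain d n" and d: "d > 0"
    and opt: "\<And>n'. nchain d n' \<Longrightarrow> (\<Sum>i<d. n i) \<le> (\<Sum>i<d. n' i)"
    and n': "nchain d n'"
  shows "n 0 \<le> n' 0"
proof -
  obtain x
    where "\<forall>i<d. \<forall>l<k. vec (x i) l = int (cum k (digit p (n i)) l m)"
    by (rule exE[OF nchain_vec[OF n]])
  then have x: "\<And>i l. i < d \<Longrightarrow> l < k \<Longrightarrow> vec (x i) l = int (cum k (digit p (n i)) l m)" by simp
  obtain y
    where "\<forall>i<d. \<forall>l<k. vec (y i) l = int (cum k (digit p (n' i)) l m)"
    by (rule exE[OF nchain_vec[OF n']])
  then have y: "\<And>i l. i < d \<Longrightarrow> l < k \<Longrightarrow> vec (y i) l = int (cum k (digit p (n' i)) l m)" by simp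
  define t where "t l = max (x 0 l) (y 0 l)" for l
  obtain d' where d': "d = Suc d'" using d by (cases d) auto
  have o: "optimal d t x" and e: "cost1 (x 0) = int (n 0)"
    using nchain_optimal[OF n d opt x, where t = t] d by (auto simp: t_def)
  have "chain d t y" by (rule nchain_chain[OF n' y]) (auto simp: t_def)
  then have "cost1 (x 0) \<le> cost1 (y 0)" using optimal_top_least o by (simp add: d')
  also have "\<dots> \<le> int (n' 0)"
    by (rule vec_feas(2)[OF nchain_submask[OF n' d]]) (use y d in auto)
  finally show ?thesis using e by simp
qed

theorem nchain_last_least_prime:
  assumes n: "nchain d n" and d: "d > 0" and k1: "k = 1"
    and opt: "\<And>n'. nchain d n' \<Longrightarrow> (\<Sum>i<d. n i) \<le> (\<Sum>i<d. n' i)"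
    and n0: "submask p n0 m" "[n0 = r] (mod (p ^ k - 1))"
  shows "n (d - 1) \<le> n0"
proof -
  obtain x
    where "\<forall>i<d. \<forall>l<k. vec (x i) l = int (cum k (digit p (n i)) l m)"
    by (rule exE[OF nchain_vec[OF n]])
  then have x: "\<And>i l. i < d \<Longrightarrow> l < k \<Longrightarrow> vec (x i) l = int (cum k (digit p (n i)) l m)" by simp
  from vec_exists[OF n0] obtain y where "\<forall>l<k. vec y l = int (cum k (digit p n0) l m)" ..
  then have y: "\<And>l. l < k \<Longrightarrow> vec y l = int (cum k (digit p n0) l m)" by simp
  have o: "optimal d (x 0) x" and e: "cost1 (x (d - 1)) = int (n (d - 1))"
    using nchain_optimal[OF n d opt x, where t = "x 0"] d by auto
  have ch: "chain d (x 0) x" using o by (simp add: optimal_def)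
  have fy: "feas y" and cy: "cost1 y \<le> int n0"
    using vec_feas[OF n0(1)] y by blast+
  have "cost1 (x (d - 1)) \<le> cost1 y"
  proof (cases "y 0 \<le> x (d - 1) 0")
    case True
    have "chain d (x 0) (x(d - 1 := y))"
    proof (rule chain_update[OF ch])
      show "below y (x 0)" if "d - 1 = 0" unfolding below_def using True that k1 by auto
      show "far_below y (x j)" if "d - 1 = Suc j" for j
      proof -
        have "far_below (x (Suc j)) (x j)" using ch that by (auto simp: chain_def)
        then show ?thesis unfolding far_below_def using True that k1 by (auto simp: lessThan_Suc)
      qed
    qed (use fy d in auto)
    then have "cost d x \<le> cost d (x(d - 1 := y))" using o by (auto simp: optimal_def)
    then show ?thesis using d by (simp add: cost_update)
  next
    case False
    have "vec (x (d - 1)) 0 \<le> vec y 0"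
      using False k1 p_ge mult_left_mono[of "x (d - 1) 0" "y 0" "int p - 1"]
      by (simp add: slack_def algebra_simps)
    moreover have "0 \<le> vec (x (d - 1)) 0" using x[of "d - 1" 0] d k1 by simp
    moreover have "{..<k} = {0}" using k1 by auto
    ultimately show ?thesis unfolding cost1_def price_def by (simp add: phi_mono)
  qed
  then show ?thesis using e cy by simp
qed

lemma decomps_iff:
  assumes q: "q = p ^ k" and r: "int r = z mod int (q - 1)" and d: "d \<ge> 1" and len: "length ms = d + 1"
  shows "ms \<in> decomps p q z m d \<longleftrightarrow> sum_list ms = m \<and> nchain d (\<lambda>i. tail_sum ms (Suc i))"
proof -
  have ts: "tail_sum ms i = ms ! i + tail_sum ms (Suc i)" if "i \<le> d" for i
    using that len by (intro tail_sum_Suc) simp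
  have last: "tail_sum ms (Suc d) = 0" using len by (intro tail_sum_beyond) simp
  have td: "tail_sum ms d = ms ! d" using ts[of d] last by simp
  have all_iff: "(\<forall>i<length ms. P i) \<longleftrightarrow> P 0 \<and> (\<forall>i. Suc i < d \<longrightarrow> P (Suc i)) \<and> P d" for P
  proof
    assume R: "P 0 \<and> (\<forall>i. Suc i < d \<longrightarrow> P (Suc i)) \<and> P d"
    show "\<forall>i<length ms. P i"
    proof (intro allI impI)
      fix i assume "i < length ms"
      then have "i < d \<or> i = d" using len by auto
      then show "P i" using R by (cases i) auto
    qed
  qed (use d len in auto)
  have P0: "submask p (tail_sum ms (Suc d)) (tail_sum ms d)" by (simp add: last submask_def)
  have pos: "0 < ms ! i \<longleftrightarrow> tail_sum ms (Suc i) \<noteq> tail_sum ms i" if "i \<le> d" for i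
    using ts[OF that] by simp
  have dvd: "(q - 1) dvd ms ! i \<longleftrightarrow> [tail_sum ms i = tail_sum ms (Suc i)] (mod (q - 1))" if "i \<le> d" for i
    using ts[OF that] by (simp add: cong_altdef_nat)
  have "(\<forall>i. 0 < i \<and> i < d \<longrightarrow> (q - 1) dvd ms ! i) \<and> int (q - 1) dvd z - int (ms ! d)
      \<longleftrightarrow> (\<forall>i<d. [tail_sum ms (Suc i) = r] (mod (q - 1)))" (is "?L \<longleftrightarrow> ?R")
  proof
    assume L: ?L
    have "[tail_sum ms i = r] (mod (q - 1))" if "i \<le> d" "0 < i" for i
      using that
    proof (induction rule: inc_induct)
      case base
      then show ?case using L cong_residue_iff[OF r] by (simp add: td)
    next
      case (step n)
      then have "[tail_sum ms n = tail_sum ms (Suc n)] (mod (q - 1))" using L dvd[of n] by simp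
      then show ?case using step by (auto intro: cong_trans)
    qed
    then show ?R by simp
  next
    assume R: ?R
    have c: "[tail_sum ms i = r] (mod (q - 1))" if "0 < i" "i \<le> d" for i
      using R that by (cases i) auto
    show ?L
    proof (intro conjI allI impI)
      fix i assume "0 < i \<and> i < d"
      then have "[tail_sum ms i = tail_sum ms (Suc i)] (mod (q - 1))"
        by (intro cong_trans[OF c[of i] cong_sym[OF c[of "Suc i"]]]) auto
      then show "(q - 1) dvd ms ! i" using dvd \<open>0 < i \<and> i < d\<close> by simp
    next
      show "int (q - 1) dvd z - int (ms ! d)" using c[of d] d cong_residue_iff[OF r] by (simp add: td)
    qed
  qed
  moreover have "(\<forall>i. 0 < i \<and> i < d \<longrightarrow> ms ! i > 0) \<longleftrightarrow>
      (\<forall>i. Suc i < d \<longrightarrow> tail_sum ms (Suc (Suc i)) \<noteq> tail_sum ms (Suc i))"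
  proof
    assume R: "\<forall>i. Suc i < d \<longrightarrow> tail_sum ms (Suc (Suc i)) \<noteq> tail_sum ms (Suc i)"
    show "\<forall>i. 0 < i \<and> i < d \<longrightarrow> ms ! i > 0"
    proof (intro allI impI)
      fix i assume "0 < i \<and> i < d"
      then show "ms ! i > 0" using R pos[of i] by (cases i) auto
    qed
  qed (use pos in auto)
  moreover have "no_carry p ms \<longleftrightarrow> submask p (tail_sum ms (Suc 0)) m \<and>
      (\<forall>i. Suc i < d \<longrightarrow> submask p (tail_sum ms (Suc (Suc i))) (tail_sum ms (Suc i)))"
    if "sum_list ms = m"
    using all_iff[of "\<lambda>i. submask p (tail_sum ms (Suc i)) (tail_sum ms i)"] P0 that
    by (simp add: no_carry_iff[OF p_ge] tail_sum_0)
  moreover have "ms \<in> decomps p q z m d \<longleftrightarrow> sum_list ms = m \<and> no_carry p ms \<and>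
      (\<forall>i. 0 < i \<and> i < d \<longrightarrow> ms ! i > 0) \<and>
      ((\<forall>i. 0 < i \<and> i < d \<longrightarrow> (q - 1) dvd ms ! i) \<and> int (q - 1) dvd z - int (ms ! d))"
    unfolding decomps_def using len by auto
  ultimately show ?thesis unfolding nchain_def q[symmetric] by blast
qed

lemma nchain_decomposition:
  assumes q: "q = p ^ k" and r: "int r = z mod int (q - 1)" and d: "d \<ge> 1" and n: "nchain d n"
  shows "\<exists>ms\<in>decomps p q z m d. \<forall>i<d. tail_sum ms (Suc i) = n i"
proof -
  define N where "N i = (if i = 0 then m else if i \<le> d then n (i - 1) else 0)" for i
  define ms where "ms = map (\<lambda>i. N i - N (Suc i)) [0..<Suc d]"
  have "N (Suc i) \<le> N i" if "i < Suc d" for i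
  proof (cases i)
    case 0
    then show ?thesis using n d submask_le[OF p_ge] by (simp add: N_def nchain_def)
  next
    case (Suc i')
    then show ?thesis using n that submask_le[OF p_ge] by (auto simp: N_def nchain_def)
  qed
  then have ts: "tail_sum ms j = N j" if "j \<le> Suc d" for j
    unfolding ms_def using that tail_sum_telescope[of "Suc d" N j] by (simp add: N_def)
  have tn: "tail_sum ms (Suc i) = n i" if "i < d" for i using ts[of "Suc i"] that by (simp add: N_def)
  have "length ms = d + 1" by (simp add: ms_def)
  moreover have "sum_list ms = m" using ts[of 0] by (simp add: tail_sum_0 N_def)
  moreover have "nchain d (\<lambda>i. tail_sum ms (Suc i))"
    using n tn d by (auto simp: nchain_def)
  ultimately show ?thesis using decomps_iff[OF q r d] tn by blast
qed

lemma nchain_greedy: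
  assumes n: "nchain d n" and opt: "\<And>n'. nchain d n' \<Longrightarrow> (\<Sum>i<d. n i) \<le> (\<Sum>i<d. n' i)"
    and n': "nchain d n'" and i: "i < d" and eq: "\<And>j. j < i \<Longrightarrow> n' j = n j"
  shows "n i \<le> n' i"
proof (cases i)
  case 0
  then show ?thesis using nchain_first_least[OF n _ opt n'] i by simp
next
  case (Suc j)
  interpret S: digit_system p k "n j" r by standard (rule p_ge k_pos)+
  define d' where "d' = d - i"
  have d': "d' > 0" "d = i + d'" using i by (simp_all add: d'_def)
  have shift: "S.nchain d' (\<lambda>a. x (i + a))" if "nchain d x" "x j = n j" for x
    using that Suc i unfolding nchain_def S.nchain_def d'_def by auto
  obtain o' where o': "S.nchain d' o'" and least: "\<And>x. S.nchain d' x \<Longrightarrow> (\<Sum>a<d'. o' a) \<le> (\<Sum>a<d'. x a)"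
    using ex_has_least_nat[of "S.nchain d'" "\<lambda>a. n (i + a)" "\<lambda>x. \<Sum>a<d'. x a"] shift[OF n] by blast
  have ni: "S.nchain d' (\<lambda>a. n (i + a))" by (rule shift[OF n]) simp
  have "o' 0 \<le> n i" using S.nchain_first_least[OF o' d'(1) least ni] by simp
  also have "n i \<noteq> n j" "n i \<le> n j" using n i Suc submask_le[OF p_ge] by (auto simp: nchain_def)
  then have "n i < n j" by simp
  finally have o0: "o' 0 \<noteq> n j" by simp
  define x where "x a = (if a < i then n a else o' (a - i))" for a
  have "nchain d x"
    unfolding nchain_def
  proof (intro conjI allI impI)
    show "submask p (x 0) m" using n Suc by (simp add: x_def nchain_def)
    show "[x a = r] (mod (p ^ k - 1))" if "a < d" for a
      using n o' that d' by (auto simp: x_def nchain_def S.nchain_def)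
    have both: "submask p (x (Suc a)) (x a) \<and> x (Suc a) \<noteq> x a" if a: "Suc a < d" for a
    proof -
      consider "Suc a < i" | "Suc a = i" | "i \<le> a" by linarith
      then show ?thesis
      proof cases
        case 1
        then show ?thesis using n a by (auto simp: x_def nchain_def)
      next
        case 2
        then have "a = j" using Suc by simp
        then show ?thesis using o' o0 2 by (auto simp: x_def S.nchain_def)
      next
        case 3
        then have "Suc a - i = Suc (a - i)" "Suc (a - i) < d'" using a d' by auto
        then show ?thesis using o' 3 by (auto simp: x_def S.nchain_def)
      qed
    qed
    fix a assume "Suc a < d"
    then show "submask p (x (Suc a)) (x a)" "x (Suc a) \<noteq> x a" using both by blast+
  qed
  then have "(\<Sum>a<d. n a) \<le> (\<Sum>a<d. x a)" by (rule opt)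
  moreover have split: "(\<Sum>a<d. y a) = (\<Sum>a<i. y a) + (\<Sum>a<d'. y (i + a))" for y :: "nat \<Rightarrow> nat"
    unfolding d'(2) by (induction d') simp_all
  ultimately have "(\<Sum>a<d'. n (i + a)) \<le> (\<Sum>a<d'. o' a)" by (simp add: x_def)
  then have "(\<Sum>a<d'. n (i + a)) \<le> (\<Sum>a<d'. y a)" if "S.nchain d' y" for y
    using least[OF that] by simp
  from S.nchain_first_least[OF ni d'(1) this shift[OF n' eq[of j]]] show ?thesis using Suc by simp
qed

lemma nchain_optimal_unique:
  assumes n: "nchain d n" and opt: "\<And>x. nchain d x \<Longrightarrow> (\<Sum>i<d. n i) \<le> (\<Sum>i<d. x i)"
    and n': "nchain d n'" and opt': "\<And>x. nchain d x \<Longrightarrow> (\<Sum>i<d. n' i) \<le> (\<Sum>i<d. x i)"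
  shows "i < d \<Longrightarrow> n i = n' i"
proof (induction i rule: less_induct)
  case (less i)
  have "n i \<le> n' i" by (rule nchain_greedy[OF n opt n']) (use less in auto)
  moreover have "n' i \<le> n i" by (rule nchain_greedy[OF n' opt' n]) (use less in auto)
  ultimately show ?case by simp
qed

lemma nchain_last_least:
  assumes n: "nchain d n" and d: "d \<ge> 1" and opt: "\<And>n'. nchain d n' \<Longrightarrow> (\<Sum>i<d. n i) \<le> (\<Sum>i<d. n' i)"
    and special: "k = 1 \<or> d = 1 \<or> r = 0"
    and n0: "submask p n0 m" "[n0 = r] (mod (p ^ k - 1))"
  shows "n (d - 1) \<le> n0"
  using special
proof (elim disjE)
  assume "k = 1"
  then show ?thesis using nchain_last_least_prime[OF n _ _ opt n0] d by simp
next
  assume d1: "d = 1"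
  then have "nchain d (\<lambda>_. n0)" using n0 by (simp add: nchain_def)
  then show ?thesis using nchain_first_least[OF n _ opt] d1 by fastforce
next
  assume r0: "r = 0"
  have "n (d - 1) = 0"
  proof (rule ccontr)
    assume pos: "n (d - 1) \<noteq> 0"
    have "nchain d (n(d - 1 := 0))"
      unfolding nchain_def
    proof (intro conjI allI impI)
      show "submask p ((n(d - 1 := 0)) 0) m" using n by (simp add: nchain_def submask_def)
      show "[(n(d - 1 := 0)) i = r] (mod (p ^ k - 1))" if "i < d" for i
      proof -
        have "[n i = r] (mod (p ^ k - 1))" using n that by (simp add: nchain_def)
        then show ?thesis using r0 by simp
      qed
      fix i assume i: "Suc i < d"
      have s: "submask p (n (Suc i)) (n i)" "n (Suc i) \<noteq> n i" using n i by (auto simp: nchain_def)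
      show "submask p ((n(d - 1 := 0)) (Suc i)) ((n(d - 1 := 0)) i)" using s i by (auto simp: submask_def)
      show "(n(d - 1 := 0)) (Suc i) \<noteq> (n(d - 1 := 0)) i" using s i submask_le[OF p_ge s(1)] by auto
    qed
    then have "(\<Sum>i<d. n i) \<le> (\<Sum>i<d. (n(d - 1 := 0)) i)" by (rule opt)
    moreover have "(\<Sum>i<d. (n(d - 1 := 0)) i) < (\<Sum>i<d. n i)"
      by (rule sum_strict_mono_ex1) (use pos d in \<open>auto intro!: bexI[of _ "d - 1"]\<close>)
    ultimately show False by simp
  qed
  then show ?thesis by simp
qed

end

section \<open>Power sums\<close>

lemma prime_dvd_choose_mult:
  assumes "prime p" "\<not> p dvd s"
  shows "p dvd (p * a choose s)"
proof (cases "a = 0 \<or> s = 0")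
  case True
  then show ?thesis using assms by (cases s) auto
next
  case False
  obtain s' where s: "s = Suc s'" using False by (cases s) auto
  obtain n' where n: "p * a = Suc n'" using False assms(1) prime_gt_0_nat[of p] by (cases "p * a") auto
  have "s * (p * a choose s) = p * a * (n' choose s')"
    unfolding s n by (rule Suc_times_binomial)
  then have "p dvd s * (p * a choose s)" by (simp add: mult.assoc)
  then show ?thesis using assms by (simp add: prime_dvd_mult_iff)
qed

lemma choose_mult_cong:
  assumes p: "prime p"
  shows "[(p * a choose (p * c)) = (a choose c)] (mod p)"
proof (induction a arbitrary: c)
  case 0
  have "0 < p * c" if "c \<noteq> 0" using that p by (simp add: prime_gt_0_nat)
  then show ?case by (cases "c = 0") (simp_all add: binomial_eq_0)
next
  case (Suc a)
  show ?case
  proof (cases c)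
    case (Suc c')
    have p0: "0 < p" using p by (simp add: prime_gt_0_nat)
    have "(p * Suc a choose (p * c)) = (\<Sum>s\<le>p * c. (p choose s) * (p * a choose (p * c - s)))"
      using vandermonde[of p "p * a" "p * c"] by simp
    also have "[\<dots> = (\<Sum>s\<le>p * c. if s = 0 then (a choose c) else if s = p then (a choose c') else 0)] (mod p)"
    proof (rule cong_sum)
      fix s assume "s \<in> {..p * c}"
      consider "s = 0" | "s = p" | "s > p" | "0 < s" "s < p" by linarith
      then show "[(p choose s) * (p * a choose (p * c - s)) =
          (if s = 0 then (a choose c) else if s = p then (a choose c') else 0)] (mod p)"
      proof cases
        case 1
        then show ?thesis using Suc.IH by simp
      next
        case 2
        have "p * c - p = p * c'" using Suc by simp
        then show ?thesis using 2 Suc.IH p0 by simp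
      next
        case 3
        then show ?thesis using p0 by (simp add: binomial_eq_0)
      next
        case 4
        then have "p dvd (p choose s)" using p by (intro dvd_choose_prime) auto
        then show ?thesis using 4 by (simp add: cong_0_iff)
      qed
    qed
    also have "(\<Sum>s\<le>p * c. if s = 0 then (a choose c) else if s = p then (a choose c') else 0) =
        (\<Sum>s\<in>{0, p}. if s = 0 then (a choose c) else if s = p then (a choose c') else 0)"
      by (rule sum.mono_neutral_right) (use Suc p0 in auto)
    also have "\<dots> = (Suc a choose c)" using p0 Suc by (simp add: add.commute)
    finally show ?thesis .
  qed simp
qed

lemma lucas_step:
  assumes p: "prime p" and b: "b < p" and e: "e < p"
  shows "[(p * a + b choose (p * c + e)) = (a choose c) * (b choose e)] (mod p)"
proof -
  have "(p * a + b choose (p * c + e)) = (\<Sum>s\<le>p * c + e. (p * a choose s) * (b choose (p * c + e - s)))"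
    using vandermonde[of "p * a" b "p * c + e"] by simp
  also have "[\<dots> = (\<Sum>s\<le>p * c + e. if s = p * c then (a choose c) * (b choose e) else 0)] (mod p)"
  proof (rule cong_sum)
    fix s assume s: "s \<in> {..p * c + e}"
    show "[(p * a choose s) * (b choose (p * c + e - s)) =
        (if s = p * c then (a choose c) * (b choose e) else 0)] (mod p)"
    proof (cases "s = p * c")
      case True
      then show ?thesis using choose_mult_cong[OF p, of a c] by (auto intro: cong_mult)
    next
      case False
      show ?thesis
      proof (cases "p dvd s")
        case True
        then obtain c' where c': "s = p * c'" by (auto elim: dvdE)
        have "c' < c"
        proof (rule ccontr)
          assume "\<not> c' < c"
          then have "c + 1 \<le> c'" using False c' by (cases "c' = c") auto
          then have "p * (c + 1) \<le> p * c'" by (rule mult_le_mono2)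
          then show False using s c' e by simp
        qed
        then have "p * (c' + 1) \<le> p * c" by (intro mult_le_mono2) simp
        then have "b < p * c + e - s" using c' b by simp
        then show ?thesis using False by (simp add: binomial_eq_0)
      next
        case nd: False
        then have "p dvd (p * a choose s)" using prime_dvd_choose_mult[OF p] by simp
        then show ?thesis using False by (simp add: cong_0_iff)
      qed
    qed
  qed
  also have "(\<Sum>s\<le>p * c + e. if s = p * c then (a choose c) * (b choose e) else 0) = (a choose c) * (b choose e)"
    by simp
  finally show ?thesis .
qed

lemma prime_dvd_choose_small:
  assumes "prime p" "b < p"
  shows "p dvd (b choose e) \<longleftrightarrow> b < e"
proof
  assume d: "p dvd (b choose e)"
  show "b < e"
  proof (rule ccontr)
    assume "\<not> b < e"
    then have "(b choose e) dvd fact b"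
      using binomial_fact_lemma[of e b] by (metis dvd_triv_right not_less)
    then have "p dvd fact b" using d dvd_trans by blast
    then show False using assms by (simp add: prime_dvd_fact_iff)
  qed
qed (simp add: binomial_eq_0)

lemma submask_step:
  assumes "b < p" "e < p"
  shows "submask p (p * c + e) (p * a + b) \<longleftrightarrow> submask p c a \<and> e \<le> b"
proof -
  have 0: "digit p (p * a + b) 0 = b" if "b < p" for a b using that by (simp add: digit_def)
  have S: "digit p (p * a + b) (Suc i) = digit p a i" if "b < p" for a b i
    using that by (simp add: digit_def div_mult2_eq)
  show ?thesis
    unfolding submask_def using 0 S assms by (metis nat.exhaust)
qed

theorem prime_dvd_choose_iff:
  assumes p: "prime p"
  shows "p dvd (n choose i) \<longleftrightarrow> \<not> submask p i n"
proof (induction n arbitrary: i rule: less_induct)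
  case (less n)
  have p2: "2 \<le> p" using p by (rule prime_ge_2_nat)
  show ?case
  proof (cases "n = 0")
    case True
    show ?thesis
    proof (cases "i = 0")
      case True
      then show ?thesis using p2 \<open>n = 0\<close> by simp
    next
      case False
      then have "\<not> submask p i n" using submask_le[OF p2, of i n] True by auto
      then show ?thesis using True False by (simp add: binomial_eq_0)
    qed
  next
    case False
    define a b c e where "a = n div p" "b = n mod p" "c = i div p" "e = i mod p"
    have bp: "b < p" "e < p" using p2 by (simp_all add: a_b_c_e_def)
    have n: "n = p * a + b" "i = p * c + e" by (simp_all add: a_b_c_e_def)
    have "a < n" using False p2 by (simp add: a_b_c_e_def)
    have "p dvd (n choose i) \<longleftrightarrow> p dvd (a choose c) * (b choose e)"
      using cong_dvd_iff[OF lucas_step[OF p bp]] unfolding n by blast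
    also have "\<dots> \<longleftrightarrow> \<not> (submask p c a \<and> e \<le> b)"
      using less[OF \<open>a < n\<close>, of c] prime_dvd_choose_small[OF p bp(1), of e] p
      by (auto simp: prime_dvd_mult_iff)
    finally show ?thesis unfolding n using submask_step[OF bp] by simp
  qed
qed

lemma of_nat_card_field: "of_nat (card (UNIV :: 'a set)) = (0 :: 'a::{finite,field})"
proof -
  have "(\<Sum>x\<in>UNIV. x + 1) = (\<Sum>x\<in>UNIV. x :: 'a)"
    by (rule sum.reindex_bij_witness[of _ "\<lambda>x. x - 1" "\<lambda>x. x + 1"]) auto
  then show ?thesis by (simp add: sum.distrib)
qed

lemma CHAR_eq:
  assumes "prime p" "q = p ^ k" "card (UNIV :: 'a::{finite,field} set) = q"
  shows "CHAR('a) = p"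
proof -
  have "CHAR('a) > 0" by (rule finite_imp_CHAR_pos) simp
  then have "prime CHAR('a)" by (rule prime_CHAR_semidom)
  moreover have "CHAR('a) dvd card (UNIV :: 'a set)"
    using of_nat_card_field[where 'a = 'a] by (simp only: of_nat_eq_0_iff_char_dvd)
  ultimately show ?thesis using assms by (metis prime_dvd_power primes_dvd_imp_eq)
qed

lemma finite_field_power_pred:
  fixes x :: "'a::{finite,field}"
  assumes "x \<noteq> 0"
  shows "x ^ (card (UNIV :: 'a set) - 1) = 1"
proof -
  have "(\<Prod>y\<in>UNIV - {0}. x * y) = (\<Prod>y\<in>UNIV - {0}. y)"
    by (rule prod.reindex_bij_witness[of _ "\<lambda>y. y / x" "\<lambda>y. x * y"]) (use assms in auto)
  then have "x ^ card (UNIV - {0 :: 'a}) * (\<Prod>y\<in>UNIV - {0}. y) = 1 * (\<Prod>y\<in>UNIV - {0 :: 'a}. y)"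
    by (simp add: prod.distrib)
  moreover have "(\<Prod>y\<in>UNIV - {0 :: 'a}. y) \<noteq> 0" by simp
  ultimately show ?thesis by (simp add: card_Diff_singleton)
qed

lemma sum_powi_nonzero:
  fixes z :: int
  assumes q: "card (UNIV :: 'a::{finite,field} set) = q"
  shows "(\<Sum>x\<in>UNIV - {0}. (x :: 'a) powi z) = (if int (q - 1) dvd z then - 1 else 0)"
proof -
  have q2: "q \<ge> 2" using card_mono[of "UNIV :: 'a set" "{0, 1}"] q by simp
  have one: "x powi (int (q - 1) * w) = 1" if "x \<noteq> 0" for x :: 'a and w
    using finite_field_power_pred[OF that] q by (simp add: power_int_mult)
  show ?thesis
  proof (cases "int (q - 1) dvd z")
    case True
    then obtain w where "z = int (q - 1) * w" by (rule dvdE)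
    then have "(\<Sum>x\<in>UNIV - {0}. (x :: 'a) powi z) = (\<Sum>x\<in>UNIV - {0 :: 'a}. 1)"
      using one by (intro sum.cong) auto
    also have "\<dots> = of_nat (q - 1)" using q by (simp add: card_Diff_singleton)
    also have "\<dots> = - 1"
    proof -
      have "of_nat q = (0 :: 'a)" using of_nat_card_field[where 'a = 'a] q by simp
      then show ?thesis using q2 by (simp add: of_nat_diff)
    qed
    finally show ?thesis using True by simp
  next
    case False
    define j where "j = nat (z mod int (q - 1))"
    have j: "0 < j" "j < q - 1" "int j = z mod int (q - 1)"
    proof -
      define X where "X = z mod int (q - 1)"
      have "0 < int (q - 1)" using q2 by simp
      then have "0 \<le> X" "X < int (q - 1)" by (simp_all only: X_def pos_mod_sign pos_mod_bound)
      moreover have "X \<noteq> 0" using False by (simp only: X_def dvd_eq_mod_eq_0 not_False_eq_True)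
      moreover have "j = nat X" by (simp only: j_def X_def)
      ultimately show "0 < j" "j < q - 1" "int j = z mod int (q - 1)" unfolding X_def[symmetric] by linarith+
    qed
    have zj: "x powi z = x ^ j" if "x \<noteq> 0" for x :: 'a
    proof -
      have "z = int (q - 1) * (z div int (q - 1)) + int j" using j(3) by simp
      then show ?thesis using that one[OF that] by (metis mult_1 power_int_add power_int_of_nat)
    qed
    have "\<exists>g\<in>UNIV - {0 :: 'a}. g powi z \<noteq> 1"
    proof (rule ccontr)
      assume "\<not> ?thesis"
      then have "x ^ j = 1" if "x \<noteq> 0" for x :: 'a using zj that by simp
      define f where "f = monom (1 :: 'a) j - 1"
      have "coeff f j = 1" using j by (simp add: f_def)
      then have "f \<noteq> 0" by auto
      have "UNIV - {0 :: 'a} \<subseteq> {x. poly f x = 0}"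
        using \<open>\<And>x :: 'a. x \<noteq> 0 \<Longrightarrow> x ^ j = 1\<close> by (auto simp: f_def poly_monom)
      then have "card (UNIV - {0 :: 'a}) \<le> card {x. poly f x = 0}" by (intro card_mono) auto
      also have "\<dots> \<le> degree f" using \<open>f \<noteq> 0\<close> by (rule card_poly_roots_bound)
      also have "\<dots> \<le> j" unfolding f_def by (intro degree_diff_le) (auto simp: degree_monom_eq)
      finally show False using j q by (simp add: card_Diff_singleton)
    qed
    then obtain g :: 'a where g: "g \<noteq> 0" "g powi z \<noteq> 1" by auto
    have "(\<Sum>x\<in>UNIV - {0}. (x :: 'a) powi z) = (\<Sum>x\<in>UNIV - {0}. (g * x) powi z)"
      by (rule sum.reindex_bij_witness[of _ "\<lambda>x. g * x" "\<lambda>x. x / g"]) (use g in auto)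
    also have "\<dots> = g powi z * (\<Sum>x\<in>UNIV - {0}. x powi z)"
      by (simp add: power_int_mult_distrib sum_distrib_left)
    finally have "(g powi z - 1) * (\<Sum>x\<in>UNIV - {0}. x powi z) = 0" by (simp add: algebra_simps)
    then show ?thesis using g False by auto
  qed
qed

lemma sum_power_field:
  assumes q: "card (UNIV :: 'a::{finite,field} set) = q"
  shows "(\<Sum>x\<in>UNIV. (x :: 'a) ^ j) = (if 0 < j \<and> (q - 1) dvd j then - 1 else 0)"
proof -
  have "(\<Sum>x\<in>UNIV. (x :: 'a) ^ j) = 0 ^ j + (\<Sum>x\<in>UNIV - {0}. (x :: 'a) ^ j)"
    by (rule sum.remove) auto
  also have "(\<Sum>x\<in>UNIV - {0}. (x :: 'a) ^ j) = (if (q - 1) dvd j then - 1 else 0)"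
    using sum_powi_nonzero[OF q, of "int j"] by simp
  finally show ?thesis by (cases "j = 0") auto
qed

lemma smult_sum_right: "smult c (\<Sum>i\<in>A. f i) = (\<Sum>i\<in>A. smult c (f i))"
  by (induction A rule: infinite_finite_induct) (auto simp: smult_add_right)

definition monic :: "nat \<Rightarrow> 'a::{finite,field} poly set" where
  "monic d = {a. lead_coeff a = 1 \<and> degree a = d}"

lemma monic_0: "monic 0 = {1}"
  by (auto simp: monic_def elim!: degree_eq_zeroE)

locale linear_place =
  fixes v :: "'a::{finite,field} poly" and p k q :: nat
  assumes prime_p: "prime p" and q_eq: "q = p ^ k" and k_pos: "k > 0"
    and card_q: "card (UNIV :: 'a set) = q"
    and v_monic: "lead_coeff v = 1" and v_deg: "degree v = 1"
begin

lemma v_ne: "v \<noteq> 0" using v_deg by auto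

lemma degree_v_mult: "b \<noteq> 0 \<Longrightarrow> degree (v * b) = Suc (degree b)"
  using v_ne v_deg by (simp add: degree_mult_eq)

lemma horner_in_monic: "[:c:] + v * b \<in> monic (Suc d) \<longleftrightarrow> b \<in> monic d"
proof (cases "b = 0")
  case True
  then show ?thesis by (auto simp: monic_def)
next
  case False
  have dg: "degree (v * b) = Suc (degree b)" by (rule degree_v_mult[OF False])
  have "degree ([:c:] + v * b) = Suc (degree b)"
    using degree_add_eq_right[of "[:c:]" "v * b"] dg by simp
  moreover have "coeff ([:c:] + v * b) (Suc (degree b)) = lead_coeff b"
    using lead_coeff_mult[of v b] v_monic dg by simp
  ultimately show ?thesis by (auto simp: monic_def)
qed

lemma horner_exists: "\<exists>c b. a = [:c:] + v * b"
proof -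
  have "degree (a mod v) = 0"
    using degree_mod_less[OF v_ne, of a] v_deg by auto
  then obtain c where "a mod v = [:c:]" by (rule degree_eq_zeroE)
  then have "a = [:c:] + v * (a div v)" using mod_mult_div_eq[of a v] by simp
  then show ?thesis by blast
qed

lemma not_v_dvd_const: "c \<noteq> 0 \<Longrightarrow> \<not> v dvd [:c:]"
  using dvd_imp_degree_le[of v "[:c:]"] v_deg by auto

lemma horner_unique: "[:c:] + v * b = [:c':] + v * b' \<longleftrightarrow> c = c' \<and> b = b'"
proof
  assume eq: "[:c:] + v * b = [:c':] + v * b'"
  have d: "[:c - c':] = v * (b' - b)"
  proof -
    have "x - x' = y' - y" if "x + y = x' + y'" for x x' y y' :: "'a poly"
      using that by (simp add: algebra_simps)
    from this[OF eq] show ?thesis by (simp add: right_diff_distrib)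
  qed
  then have "c = c'" using not_v_dvd_const[of "c - c'"] by (metis dvd_triv_left right_minus_eq)
  then show "c = c' \<and> b = b'" using eq v_ne by auto
qed auto

lemma bij_horner: "bij_betw (\<lambda>(c, b). [:c:] + v * b) (UNIV \<times> monic d) (monic (Suc d))"
  unfolding bij_betw_def
proof
  show "inj_on (\<lambda>(c, b). [:c:] + v * b) (UNIV \<times> monic d)"
    by (auto simp: inj_on_def horner_unique)
  show "(\<lambda>(c, b). [:c:] + v * b) ` (UNIV \<times> monic d) = monic (Suc d)"
  proof (intro equalityI subsetI)
    fix a :: "'a poly" assume a: "a \<in> monic (Suc d)"
    obtain c b where "a = [:c:] + v * b" using horner_exists by blast
    then show "a \<in> (\<lambda>(c, b). [:c:] + v * b) ` (UNIV \<times> monic d)" using a horner_in_monic by force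
  qed (auto simp: horner_in_monic)
qed

lemma coprime_horner: "coprime v ([:c:] + v * b) \<longleftrightarrow> c \<noteq> 0"
proof
  assume "coprime v ([:c:] + v * b)"
  then show "c \<noteq> 0"
    using v_deg is_unit_iff_degree[OF v_ne] by (auto simp: coprime_def)
next
  assume c: "c \<noteq> 0"
  then have "is_unit [:c:]" by (simp add: is_unit_const_poly_iff dvd_field_iff)
  show "coprime v ([:c:] + v * b)"
  proof (rule coprimeI)
    fix e assume "e dvd v" "e dvd [:c:] + v * b"
    then have "e dvd [:c:]" by (metis dvd_add_left_iff dvd_mult2)
    then show "is_unit e" using \<open>is_unit [:c:]\<close> dvd_trans by blast
  qed
qed

lemma omega_horner:
  assumes "c \<noteq> 0"
  shows "omega v ([:c:] + v * b) = c"
proof -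
  have "[[:c:] + v * b = [:e:]] (mod v) \<longleftrightarrow> e = c" for e
  proof -
    have "[:e:] mod v = [:e:]" for e using v_deg by (intro mod_poly_less) auto
    then show ?thesis by (auto simp: cong_def)
  qed
  then show ?thesis unfolding omega_def using assms by auto
qed

lemma vpow_horner:
  assumes "c \<noteq> 0"
  shows "vpow v ([:c:] + v * b) z m = smult (c powi (z - int m)) (([:c:] + v * b) ^ m)"
  unfolding vpow_def omega_horner[OF assms] smult_power smult_smult
  using assms by (simp add: power_int_diff divide_inverse power_inverse)

definition psum :: "nat \<Rightarrow> nat \<Rightarrow> 'a poly" where
  "psum d n = (\<Sum>a\<in>monic d. a ^ n)"

lemma horner_power_sum:
  "(\<Sum>b\<in>monic d. ([:c:] + v * b) ^ n) = (\<Sum>i\<le>n. [:of_nat (n choose i) * c ^ (n - i):] * (v ^ i * psum d i))"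
proof -
  have "([:c:] + v * b) ^ n = (\<Sum>i\<le>n. [:of_nat (n choose i) * c ^ (n - i):] * (v ^ i * b ^ i))" for b
  proof -
    have "([:c:] + v * b) ^ n = (\<Sum>i\<le>n. of_nat (n choose i) * (v * b) ^ i * [:c:] ^ (n - i))"
      using binomial_ring[of "v * b" "[:c:]" n] by (simp add: add.commute)
    then show ?thesis
      by (simp add: power_mult_distrib of_nat_poly poly_const_pow algebra_simps)
  qed
  then have "(\<Sum>b\<in>monic d. ([:c:] + v * b) ^ n) =
      (\<Sum>b\<in>monic d. \<Sum>i\<le>n. [:of_nat (n choose i) * c ^ (n - i):] * (v ^ i * b ^ i))" by simp
  also have "\<dots> = (\<Sum>i\<le>n. \<Sum>b\<in>monic d. [:of_nat (n choose i) * c ^ (n - i):] * (v ^ i * b ^ i))"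
    by (rule sum.swap)
  finally show ?thesis by (simp add: psum_def sum_distrib_left)
qed

lemma of_nat_choose_eq_0: "of_nat (n choose i) = (0 :: 'a) \<longleftrightarrow> \<not> submask p i n"
  using CHAR_eq[OF prime_p q_eq card_q] prime_dvd_choose_iff[OF prime_p] by (simp add: of_nat_eq_0_iff_char_dvd)

lemma sum_const_poly: "(\<Sum>x\<in>A. [:f x:]) = [:\<Sum>x\<in>A. f x:]"
  by (induction A rule: infinite_finite_induct) auto

lemma psum_Suc:
  "psum (Suc d) n = (\<Sum>i | submask p i n \<and> i \<noteq> n \<and> [i = n] (mod (q - 1)).
     smult (- of_nat (n choose i)) (v ^ i * psum d i))"
proof -
  have p2: "2 \<le> p" using prime_p by (rule prime_ge_2_nat)
  have "psum (Suc d) n = (\<Sum>(c, b)\<in>UNIV \<times> monic d. ([:c:] + v * b) ^ n)"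
    unfolding psum_def using sum.reindex_bij_betw[OF bij_horner, of "\<lambda>a. a ^ n" d]
    by (simp add: case_prod_unfold)
  also have "\<dots> = (\<Sum>c\<in>UNIV. \<Sum>i\<le>n. [:of_nat (n choose i) * c ^ (n - i):] * (v ^ i * psum d i))"
    by (simp add: sum.cartesian_product[symmetric] horner_power_sum)
  also have "\<dots> = (\<Sum>i\<le>n. [:of_nat (n choose i) * (\<Sum>c\<in>UNIV. c ^ (n - i)):] * (v ^ i * psum d i))"
    by (subst sum.swap) (simp add: sum_distrib_right[symmetric] sum_const_poly sum_distrib_left del: mult_pCons_left)
  also have "\<dots> = (\<Sum>i | submask p i n \<and> i \<noteq> n \<and> [i = n] (mod (q - 1)).
     smult (- of_nat (n choose i)) (v ^ i * psum d i))"
  proof (rule sum.mono_neutral_cong_right)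
    show "{i. submask p i n \<and> i \<noteq> n \<and> [i = n] (mod (q - 1))} \<subseteq> {..n}" using submask_le[OF p2] by auto
    have dv: "0 < n - i \<and> (q - 1) dvd (n - i) \<longleftrightarrow> i \<noteq> n \<and> [i = n] (mod (q - 1))" if "i \<le> n" for i
      using that by (auto simp: cong_altdef_nat cong_sym_eq[of i n])
    show "\<forall>i\<in>{..n} - {i. submask p i n \<and> i \<noteq> n \<and> [i = n] (mod (q - 1))}.
        [:of_nat (n choose i) * (\<Sum>c\<in>UNIV. c ^ (n - i)):] * (v ^ i * psum d i) = 0"
      using of_nat_choose_eq_0 dv by (auto simp: sum_power_field[OF card_q])
    fix i assume "i \<in> {i. submask p i n \<and> i \<noteq> n \<and> [i = n] (mod (q - 1))}"
    moreover from this have "i \<le> n" using submask_le[OF p2] by simp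
    ultimately have "0 < n - i \<and> (q - 1) dvd (n - i)" using dv by blast
    then show "[:of_nat (n choose i) * (\<Sum>c\<in>UNIV. c ^ (n - i)):] * (v ^ i * psum d i) =
        smult (- of_nat (n choose i)) (v ^ i * psum d i)"
      by (simp add: sum_power_field[OF card_q])
  qed simp
  finally show ?thesis .
qed

lemma power_sum_Suc:
  "power_sum (Suc d) v z m = (\<Sum>i | submask p i m \<and> int (q - 1) dvd z - int i.
     smult (- of_nat (m choose i)) (v ^ i * psum d i))"
proof -
  have p2: "2 \<le> p" using prime_p by (rule prime_ge_2_nat)
  have "bij_betw (\<lambda>(c, b). [:c:] + v * b) ((UNIV - {0}) \<times> monic d) (monics (Suc d) v)"
  proof -
    have "(\<lambda>(c, b). [:c:] + v * b) ` ((UNIV - {0}) \<times> monic d) = monics (Suc d) v"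
    proof (intro equalityI subsetI)
      fix a assume "a \<in> monics (Suc d) v"
      then have a: "a \<in> monic (Suc d)" "coprime v a" by (auto simp: monics_def monic_def)
      obtain c b where "a = [:c:] + v * b" using horner_exists by blast
      then show "a \<in> (\<lambda>(c, b). [:c:] + v * b) ` ((UNIV - {0}) \<times> monic d)"
        using a horner_in_monic coprime_horner by force
    next
      fix a assume "a \<in> (\<lambda>(c, b). [:c:] + v * b) ` ((UNIV - {0}) \<times> monic d)"
      then obtain c b where "a = [:c:] + v * b" "c \<noteq> 0" "b \<in> monic d" by auto
      then have "a \<in> monic (Suc d)" "coprime v a" using horner_in_monic coprime_horner by auto
      then show "a \<in> monics (Suc d) v" by (auto simp: monics_def monic_def)
    qed
    then show ?thesis by (auto simp: bij_betw_def inj_on_def horner_unique)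
  qed
  from sum.reindex_bij_betw[OF this, of "\<lambda>a. vpow v a z m", symmetric]
  have "power_sum (Suc d) v z m = (\<Sum>(c, b)\<in>(UNIV - {0}) \<times> monic d. vpow v ([:c:] + v * b) z m)"
    by (simp add: power_sum_def case_prod_unfold)
  also have "\<dots> = (\<Sum>c\<in>UNIV - {0}. \<Sum>b\<in>monic d. smult (c powi (z - int m)) (([:c:] + v * b) ^ m))"
    unfolding sum.cartesian_product[symmetric] by (intro sum.cong) (auto simp: vpow_horner)
  also have "\<dots> = (\<Sum>c\<in>UNIV - {0}. \<Sum>i\<le>m. [:of_nat (m choose i) * c powi (z - int i):] * (v ^ i * psum d i))"
  proof (rule sum.cong)
    fix c :: 'a assume c: "c \<in> UNIV - {0}"
    have "(\<Sum>b\<in>monic d. smult (c powi (z - int m)) (([:c:] + v * b) ^ m))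
       = smult (c powi (z - int m)) (\<Sum>b\<in>monic d. ([:c:] + v * b) ^ m)"
      by (simp add: smult_sum_right)
    also have "\<dots> = (\<Sum>i\<le>m. [:c powi (z - int m) * (of_nat (m choose i) * c ^ (m - i)):] * (v ^ i * psum d i))"
      by (simp add: horner_power_sum smult_sum_right)
    also have "\<dots> = (\<Sum>i\<le>m. [:of_nat (m choose i) * c powi (z - int i):] * (v ^ i * psum d i))"
    proof (rule sum.cong)
      fix i assume "i \<in> {..m}"
      then have "c powi (z - int i) = c powi (z - int m) * c ^ (m - i)"
      proof -
        have "c powi (z - int i) = c powi ((z - int m) + int (m - i))"
          using \<open>i \<in> {..m}\<close> by (simp add: of_nat_diff)
        also have "\<dots> = c powi (z - int m) * c powi (int (m - i))"
          by (rule power_int_add) (use c in auto)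
        also have "c powi (int (m - i)) = c ^ (m - i)" by (rule power_int_of_nat)
        finally show ?thesis .
      qed
      then show "[:c powi (z - int m) * (of_nat (m choose i) * c ^ (m - i)):] * (v ^ i * psum d i) =
          [:of_nat (m choose i) * c powi (z - int i):] * (v ^ i * psum d i)" by (simp add: mult_ac)
    qed simp
    finally show "(\<Sum>b\<in>monic d. smult (c powi (z - int m)) (([:c:] + v * b) ^ m)) =
       (\<Sum>i\<le>m. [:of_nat (m choose i) * c powi (z - int i):] * (v ^ i * psum d i))" .
  qed simp
  also have "\<dots> = (\<Sum>i\<le>m. [:of_nat (m choose i) * (\<Sum>c\<in>UNIV - {0}. c powi (z - int i)):] * (v ^ i * psum d i))"
    by (subst sum.swap) (simp add: sum_distrib_right[symmetric] sum_const_poly sum_distrib_left del: mult_pCons_left)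
  also have "\<dots> = (\<Sum>i | submask p i m \<and> int (q - 1) dvd z - int i.
     smult (- of_nat (m choose i)) (v ^ i * psum d i))"
  proof (rule sum.mono_neutral_cong_right)
    show "{i. submask p i m \<and> int (q - 1) dvd z - int i} \<subseteq> {..m}" using submask_le[OF p2] by auto
    show "\<forall>i\<in>{..m} - {i. submask p i m \<and> int (q - 1) dvd z - int i}.
        [:of_nat (m choose i) * (\<Sum>c\<in>UNIV - {0}. c powi (z - int i)):] * (v ^ i * psum d i) = 0"
      using of_nat_choose_eq_0 by (auto simp: sum_powi_nonzero[OF card_q])
  qed (auto simp: sum_powi_nonzero[OF card_q])
  finally show ?thesis .
qed

fun descent :: "nat \<Rightarrow> nat list \<Rightarrow> bool" where
  "descent n [] = True"
| "descent n (i # ns) = (submask p i n \<and> i \<noteq> n \<and> [i = n] (mod (q - 1)) \<and> descent i ns)"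

fun coef :: "nat \<Rightarrow> nat list \<Rightarrow> 'a" where
  "coef n [] = 1"
| "coef n (i # ns) = - of_nat (n choose i) * coef i ns"

lemma coef_ne: "descent n ns \<Longrightarrow> coef n ns \<noteq> 0"
  by (induction n ns rule: coef.induct) (auto simp: of_nat_choose_eq_0)

lemma finite_submask: "finite {i. submask p i n \<and> P i}"
  by (rule finite_subset[of _ "{..n}"]) (use submask_le[OF prime_ge_2_nat[OF prime_p]] in auto)

lemma finite_descents: "finite {ns. length ns = d \<and> descent n ns}"
proof (induction d arbitrary: n)
  case (Suc d)
  have "{ns. length ns = Suc d \<and> descent n ns} \<subseteq>
      (\<Union>i\<in>{i. submask p i n \<and> True}. (#) i ` {ns. length ns = d \<and> descent i ns})"
    by (auto simp: length_Suc_conv)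
  then show ?case by (rule finite_subset) (intro finite_UN_I finite_submask finite_imageI Suc)
qed (simp add: finite_subset[of _ "{[]}"])

lemma psum_expand:
  "psum d n = (\<Sum>ns | length ns = d \<and> descent n ns. smult (coef n ns) (v ^ sum_list ns))"
proof (induction d arbitrary: n)
  case 0
  have "{ns. length ns = 0 \<and> descent n ns} = {[]}" by auto
  then show ?case by (simp add: psum_def monic_0)
next
  case (Suc d)
  define A where "A = {i. submask p i n \<and> i \<noteq> n \<and> [i = n] (mod (q - 1))}"
  have "psum (Suc d) n = (\<Sum>i\<in>A. \<Sum>ns | length ns = d \<and> descent i ns.
      smult (coef n (i # ns)) (v ^ sum_list (i # ns)))"
    unfolding psum_Suc A_def Suc by (simp add: sum_distrib_left smult_sum_right power_add)
  also have "\<dots> = (\<Sum>(i, ns)\<in>Sigma A (\<lambda>i. {ns. length ns = d \<and> descent i ns}).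
      smult (coef n (i # ns)) (v ^ sum_list (i # ns)))"
    by (rule sum.Sigma) (use finite_submask finite_descents in \<open>auto simp: A_def\<close>)
  also have "\<dots> = (\<Sum>ns | length ns = Suc d \<and> descent n ns. smult (coef n ns) (v ^ sum_list ns))"
    by (rule sum.reindex_bij_witness[of _ "\<lambda>ns. (hd ns, tl ns)" "\<lambda>(i, ns). i # ns"])
       (auto simp: A_def length_Suc_conv)
  finally show ?case .
qed

lemma power_sum_expand:
  "power_sum (Suc d) v z m = (\<Sum>ns | length ns = Suc d \<and> submask p (hd ns) m \<and>
      int (q - 1) dvd z - int (hd ns) \<and> descent (hd ns) (tl ns).
      smult (coef m ns) (v ^ sum_list ns))"
proof -
  define A where "A = {i. submask p i m \<and> int (q - 1) dvd z - int i}"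
  have "power_sum (Suc d) v z m = (\<Sum>i\<in>A. \<Sum>ns | length ns = d \<and> descent i ns.
      smult (coef m (i # ns)) (v ^ sum_list (i # ns)))"
    unfolding power_sum_Suc A_def psum_expand by (simp add: sum_distrib_left smult_sum_right power_add)
  also have "\<dots> = (\<Sum>(i, ns)\<in>Sigma A (\<lambda>i. {ns. length ns = d \<and> descent i ns}).
      smult (coef m (i # ns)) (v ^ sum_list (i # ns)))"
    by (rule sum.Sigma) (use finite_submask finite_descents in \<open>auto simp: A_def\<close>)
  also have "\<dots> = (\<Sum>ns | length ns = Suc d \<and> submask p (hd ns) m \<and>
      int (q - 1) dvd z - int (hd ns) \<and> descent (hd ns) (tl ns).
      smult (coef m ns) (v ^ sum_list ns))"
    by (rule sum.reindex_bij_witness[of _ "\<lambda>ns. (hd ns, tl ns)" "\<lambda>(i, ns). i # ns"])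
       (auto simp: A_def length_Suc_conv)
  finally show ?thesis .
qed

lemma val_unique_min:
  assumes S: "finite S" and x: "x \<in> S" and c: "c x \<noteq> 0"
    and min: "\<And>y. y \<in> S \<Longrightarrow> y \<noteq> x \<Longrightarrow> s x < s y"
  shows "val v (\<Sum>y\<in>S. smult (c y) (v ^ s y)) = enat (s x)"
proof -
  define h where "h = (\<Sum>y\<in>S - {x}. smult (c y) (v ^ (s y - s x - 1)))"
  have f: "(\<Sum>y\<in>S. smult (c y) (v ^ s y)) = v ^ s x * ([:c x:] + v * h)"
  proof -
    have "(\<Sum>y\<in>S. smult (c y) (v ^ s y)) = smult (c x) (v ^ s x) + (\<Sum>y\<in>S - {x}. smult (c y) (v ^ s y))"
      by (rule sum.remove[OF S x])
    also have "(\<Sum>y\<in>S - {x}. smult (c y) (v ^ s y)) = v ^ s x * (v * h)"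
      unfolding h_def sum_distrib_left
    proof (rule sum.cong)
      fix y assume "y \<in> S - {x}"
      then have "s y = s x + Suc (s y - s x - 1)" using min[of y] by auto
      then have "v ^ s y = v ^ s x * (v * v ^ (s y - s x - 1))" by (metis power_Suc power_add)
      then show "smult (c y) (v ^ s y) = v ^ s x * (v * smult (c y) (v ^ (s y - s x - 1)))" by simp
    qed simp
    finally show ?thesis by (simp add: algebra_simps)
  qed
  have nd: "\<not> v dvd [:c x:] + v * h" using not_v_dvd_const[OF c] by (simp add: dvd_add_left_iff)
  then have ne: "[:c x:] + v * h \<noteq> 0" by (metis dvd_0_right)
  have "{n. v ^ n dvd v ^ s x * ([:c x:] + v * h)} = {..s x}"
  proof (intro equalityI subsetI)
    fix n assume "n \<in> {n. v ^ n dvd v ^ s x * ([:c x:] + v * h)}"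
    then have n: "v ^ n dvd v ^ s x * ([:c x:] + v * h)" by simp
    show "n \<in> {..s x}"
    proof (rule ccontr)
      assume "n \<notin> {..s x}"
      then have "v ^ Suc (s x) dvd v ^ n" by (intro le_imp_power_dvd) auto
      then have "v ^ s x * v dvd v ^ s x * ([:c x:] + v * h)" using n dvd_trans by (metis power_Suc2)
      then show False using nd v_ne by (metis dvd_times_left_cancel_iff power_not_zero)
    qed
  next
    fix n assume "n \<in> {..s x}"
    then have "v ^ n dvd v ^ s x" by (intro le_imp_power_dvd) auto
    then show "n \<in> {n. v ^ n dvd v ^ s x * ([:c x:] + v * h)}" by simp
  qed
  moreover have "v ^ s x * ([:c x:] + v * h) \<noteq> 0" using ne v_ne by simp
  moreover have "Max {..s x} = s x" by (auto intro!: Max_eqI)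
  ultimately show ?thesis unfolding val_def f by simp
qed

lemma descent_iff:
  "descent n ns \<longleftrightarrow> (\<forall>i<length ns. submask p (ns ! i) ((n # ns) ! i) \<and> ns ! i \<noteq> (n # ns) ! i \<and>
     [ns ! i = (n # ns) ! i] (mod (q - 1)))"
  by (induction n ns rule: descent.induct) (auto simp: All_less_Suc2)

lemma power_sum_decomps:
  assumes r: "int r = z mod int (q - 1)" and d: "d \<ge> 1"
  shows "\<exists>c. (\<forall>ms\<in>decomps p q z m d. c ms \<noteq> 0) \<and>
    power_sum d v z m = (\<Sum>ms\<in>decomps p q z m d. smult (c ms) (v ^ weight ms))"
proof -
  interpret D: digit_system p k m r
    by standard (use prime_ge_2_nat[OF prime_p] k_pos in auto)
  obtain d' where d': "d = Suc d'" using d by (cases d) auto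
  define NC where "NC = {ns. length ns = Suc d' \<and> submask p (hd ns) m \<and>
      int (q - 1) dvd z - int (hd ns) \<and> descent (hd ns) (tl ns)}"
  have NC_iff: "ns \<in> NC \<longleftrightarrow> length ns = d \<and> D.nchain d ((!) ns)" for ns
  proof (cases "length ns = d")
    case True
    then obtain n ns' where ns: "ns = n # ns'" "length ns' = d'" by (auto simp: d' length_Suc_conv)
    have "submask p n m \<and> [n = r] (mod (q - 1)) \<and> descent n ns' \<longleftrightarrow> D.nchain d ((!) ns)"
    proof
      assume L: "submask p n m \<and> [n = r] (mod (q - 1)) \<and> descent n ns'"
      have "[ns ! i = r] (mod (q - 1))" if "i < d" for i
        using that
      proof (induction i)
        case (Suc i)
        then show ?case using L ns d' unfolding descent_iff by (auto intro: cong_trans)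
      qed (use L ns in simp)
      then show "D.nchain d ((!) ns)" using L ns d' unfolding D.nchain_def descent_iff by (auto simp: q_eq)
    next
      assume R: "D.nchain d ((!) ns)"
      have "[ns ! Suc i = ns ! i] (mod (q - 1))" if "Suc i < d" for i
        using R that unfolding D.nchain_def q_eq by (metis Suc_lessD cong_sym cong_trans)
      then show "submask p n m \<and> [n = r] (mod (q - 1)) \<and> descent n ns'"
        using R ns d' unfolding D.nchain_def descent_iff by (force simp: q_eq)
    qed
    then show ?thesis using ns d' cong_residue_iff[OF r] by (simp add: NC_def)
  qed (simp add: NC_def d')
  define tails where "tails ms = map (\<lambda>i. tail_sum ms (Suc i)) [0..<d]" for ms
  have tails_nth: "tails ms ! i = tail_sum ms (Suc i)" if "i < d" for ms i using that by (simp add: tails_def)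
  have nchain_tails: "D.nchain d ((!) (tails ms)) \<longleftrightarrow> D.nchain d (\<lambda>i. tail_sum ms (Suc i))" for ms
    using tails_nth d unfolding D.nchain_def by auto
  have len: "length ms = d + 1" "sum_list ms = m" if "ms \<in> decomps p q z m d" for ms
    using that by (auto simp: decomps_def)
  have bij: "bij_betw tails (decomps p q z m d) NC"
    unfolding bij_betw_def
  proof
    show "inj_on tails (decomps p q z m d)"
    proof (rule inj_onI)
      fix ms ms' assume m: "ms \<in> decomps p q z m d" "ms' \<in> decomps p q z m d" and eq: "tails ms = tails ms'"
      show "ms = ms'"
      proof (rule tail_sum_inj)
        fix i
        consider "i = 0" | i' where "i = Suc i'" "i' < d" | "d < i" by (metis not0_implies_Suc not_less_eq)
        then show "tail_sum ms i = tail_sum ms' i"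
        proof cases
          case 1
          then show ?thesis using m len by (simp add: tail_sum_0)
        next
          case 2
          then show ?thesis using eq tails_nth by metis
        next
          case 3
          then show ?thesis using m len by (simp add: tail_sum_beyond)
        qed
      qed (use m len in simp)
    qed
    show "tails ` decomps p q z m d = NC"
    proof (intro equalityI subsetI)
      fix ns assume "ns \<in> tails ` decomps p q z m d"
      then obtain ms where ms: "ms \<in> decomps p q z m d" "ns = tails ms" by blast
      then have "D.nchain d (\<lambda>i. tail_sum ms (Suc i))" using D.decomps_iff[OF q_eq r d len(1)] by blast
      then show "ns \<in> NC" using NC_iff nchain_tails ms by (simp add: tails_def)
    next
      fix ns assume ns: "ns \<in> NC"
      then obtain ms where ms: "ms \<in> decomps p q z m d" "\<forall>i<d. tail_sum ms (Suc i) = ns ! i"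
        using NC_iff D.nchain_decomposition[OF q_eq r d] by blast
      have "tails ms = ns" by (rule nth_equalityI) (use ns NC_iff ms in \<open>auto simp: tails_def\<close>)
      then show "ns \<in> tails ` decomps p q z m d" using ms by blast
    qed
  qed
  have wt: "sum_list (tails ms) = weight ms" if "ms \<in> decomps p q z m d" for ms
    using len(1)[OF that] by (simp add: tails_def weight_tail_sums tail_sum_beyond interv_sum_list_conv_sum_set_nat lessThan_atLeast0)
  have "power_sum d v z m = (\<Sum>ns\<in>NC. smult (coef m ns) (v ^ sum_list ns))"
    unfolding d' power_sum_expand NC_def ..
  also have "\<dots> = (\<Sum>ms\<in>decomps p q z m d. smult (coef m (tails ms)) (v ^ sum_list (tails ms)))"
    by (rule sum.reindex_bij_betw[OF bij, symmetric])
  also have "\<dots> = (\<Sum>ms\<in>decomps p q z m d. smult (coef m (tails ms)) (v ^ weight ms))"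
    using wt by (intro sum.cong) auto
  finally have "power_sum d v z m = (\<Sum>ms\<in>decomps p q z m d. smult (coef m (tails ms)) (v ^ weight ms))" .
  moreover have "coef m (tails ms) \<noteq> 0" if "ms \<in> decomps p q z m d" for ms
  proof -
    have "tails ms \<in> NC" using bij that by (auto simp: bij_betw_def)
    then show ?thesis by (cases "tails ms") (auto simp: NC_def of_nat_choose_eq_0 coef_ne)
  qed
  ultimately show ?thesis by (intro exI[of _ "\<lambda>ms. coef m (tails ms)"] conjI ballI)
qed

end

theorem theorem1:
  fixes v :: "'a :: {finite, field} poly"
    and p q m d r :: nat and z :: int
  assumes "prime p" and "\<exists>k>0. q = p ^ k" and "card (UNIV :: 'a set) = q"
    and "irreducible v" and "lead_coeff v = 1" and "degree v = 1"
    and "m > 0" and "d \<ge> 1"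
    and "int r = z mod int (q - 1)"
  shows "(decomps p q z m d = {} \<longrightarrow> val v (power_sum d v z m) = \<infinity>) \<and>
    (decomps p q z m d \<noteq> {} \<longrightarrow>
       val v (power_sum d v z m) = enat (Min (weight ` decomps p q z m d)) \<and>
       (\<exists>!ms. ms \<in> decomps p q z m d \<and> weight ms = Min (weight ` decomps p q z m d)) \<and>
       (\<forall>ms \<in> decomps p q z m d. weight ms = Min (weight ` decomps p q z m d) \<longrightarrow>
          greedy p q z r m d ms \<and>
          (q = p \<or> d = 1 \<or> r = 0 \<longrightarrow>
             ms ! d = (LEAST n. n \<in> p_power_sums p m \<and> [n = r] (mod (q - 1))))))"
proof -
  obtain k where k: "k > 0" and q: "q = p ^ k" using assms(2) by blast
  have p2: "2 \<le> p" using assms(1) by (rule prime_ge_2_nat)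
  note r = assms(9) and d = assms(8)
  interpret D: digit_system p k m r by standard (use p2 k in auto)
  interpret L: linear_place v p k q by unfold_locales (fact assms k q)+
  define DD where "DD = decomps p q z m d"
  define t where "t ms i = tail_sum ms (Suc i)" for ms i
  have fin: "finite DD" unfolding DD_def by (rule finite_decomps)
  have len: "length ms = d + 1" "sum_list ms = m" if "ms \<in> DD" for ms
    using that by (auto simp: DD_def decomps_def)
  have chain: "D.nchain d (t ms)" if "ms \<in> DD" for ms
    using D.decomps_iff[OF q r d len(1)[OF that]] that unfolding DD_def t_def by blast
  have wt: "weight ms = (\<Sum>i<d. t ms i)" if "ms \<in> DD" for ms
    using len[OF that] by (simp add: weight_tail_sums t_def tail_sum_beyond)
  have from_chain: "\<exists>ms\<in>DD. \<forall>i<d. t ms i = n i" if "D.nchain d n" for n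
    using D.nchain_decomposition[OF q r d that] by (simp add: DD_def t_def)
  have opt: "(\<Sum>i<d. t ms i) \<le> (\<Sum>i<d. n i)"
    if ms: "ms \<in> DD" "weight ms = Min (weight ` DD)" and n: "D.nchain d n" for ms n
  proof -
    obtain ns where ns: "ns \<in> DD" "\<And>i. i < d \<Longrightarrow> t ns i = n i" using from_chain[OF n] by blast
    have "weight ms \<le> weight ns" using ms ns fin by simp
    then show ?thesis using wt ms ns by simp
  qed
  have t_eqI: "ms = ms'" if ms: "ms \<in> DD" "ms' \<in> DD" and eq: "\<And>i. i < d \<Longrightarrow> t ms i = t ms' i" for ms ms'
  proof (rule tail_sum_inj)
    fix i
    consider "i = 0" | i' where "i = Suc i'" "i' < d" | "d < i" by (metis not0_implies_Suc not_less_eq)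
    then show "tail_sum ms i = tail_sum ms' i"
    proof cases
      case 1
      then show ?thesis using ms len by (simp add: tail_sum_0)
    next
      case 2
      then show ?thesis using eq by (simp add: t_def)
    next
      case 3
      then show ?thesis using ms len by (simp add: tail_sum_beyond)
    qed
  qed (use ms len in simp)
  have unique: "ms = ms'"
    if "ms \<in> DD" "weight ms = Min (weight ` DD)" "ms' \<in> DD" "weight ms' = Min (weight ` DD)" for ms ms'
  proof (rule t_eqI[OF that(1,3)])
    fix i assume "i < d"
    then show "t ms i = t ms' i"
      by (intro D.nchain_optimal_unique[of d "t ms" "t ms'"] chain opt that)
  qed
  obtain c where "(\<forall>ms\<in>DD. c ms \<noteq> 0) \<and>
      power_sum d v z m = (\<Sum>ms\<in>DD. smult (c ms) (v ^ weight ms))"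
    using L.power_sum_decomps[OF r d, of m] unfolding DD_def by (rule exE)
  then have c: "\<And>ms. ms \<in> DD \<Longrightarrow> c ms \<noteq> 0"
    and S: "power_sum d v z m = (\<Sum>ms\<in>DD. smult (c ms) (v ^ weight ms))" by simp_all
  have empty: "val v (power_sum d v z m) = \<infinity>" if "DD = {}" using S that by (simp add: val_def)
  have nonempty: "val v (power_sum d v z m) = enat (Min (weight ` DD)) \<and>
      (\<exists>!ms. ms \<in> DD \<and> weight ms = Min (weight ` DD))" if ne: "DD \<noteq> {}"
  proof -
    have "Min (weight ` DD) \<in> weight ` DD" using fin ne by simp
    then obtain ms where ms: "ms \<in> DD" "weight ms = Min (weight ` DD)" by force
    have "weight ms < weight ms'" if "ms' \<in> DD" "ms' \<noteq> ms" for ms'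
    proof -
      have "weight ms \<le> weight ms'" using ms that fin by simp
      moreover have "weight ms \<noteq> weight ms'" using unique[OF ms that(1)] ms that by auto
      ultimately show ?thesis by simp
    qed
    then have "val v (power_sum d v z m) = enat (weight ms)"
      unfolding S by (intro L.val_unique_min fin ms c) auto
    then show ?thesis using ms unique by auto
  qed
  have greedy: "greedy p q z r m d ms" if ms: "ms \<in> DD" "weight ms = Min (weight ` DD)" for ms
    unfolding greedy_def
  proof (intro conjI ballI)
    show "ms \<in> decomps p q z m d" using ms by (simp add: DD_def)
    fix i assume "i \<in> {1..d}"
    then obtain i' where i: "i = Suc i'" "i' < d" by (cases i) auto
    show "tail_sum ms i = (LEAST n. n \<in> p_power_sums p (tail_sum ms (i - 1)) \<and> [n = r] (mod (q - 1)) \<and>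
       (\<exists>ns\<in>decomps p q z m d. (\<forall>j<i. tail_sum ns j = tail_sum ms j) \<and> tail_sum ns i = n))"
    proof (rule Least_equality[symmetric], intro conjI)
      have "submask p (tail_sum ms (Suc i')) (tail_sum ms i')"
      proof (cases i')
        case 0
        then show ?thesis using chain[OF ms(1)] len[OF ms(1)] by (simp add: D.nchain_def t_def tail_sum_0)
      next
        case (Suc a)
        then show ?thesis using chain[OF ms(1)] i by (simp add: D.nchain_def t_def)
      qed
      then show "tail_sum ms i \<in> p_power_sums p (tail_sum ms (i - 1))" using i by (simp add: p_power_sums_eq[OF p2])
      show "[tail_sum ms i = r] (mod (q - 1))"
        using chain[OF ms(1)] i by (simp add: D.nchain_def t_def q)
      show "\<exists>ns\<in>decomps p q z m d. (\<forall>j<i. tail_sum ns j = tail_sum ms j) \<and> tail_sum ns i = tail_sum ms i"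
        using ms by (auto simp: DD_def)
      fix n assume "n \<in> p_power_sums p (tail_sum ms (i - 1)) \<and> [n = r] (mod (q - 1)) \<and>
       (\<exists>ns\<in>decomps p q z m d. (\<forall>j<i. tail_sum ns j = tail_sum ms j) \<and> tail_sum ns i = n)"
      then obtain ns where ns: "ns \<in> DD" "\<And>j. j < i \<Longrightarrow> tail_sum ns j = tail_sum ms j" "tail_sum ns i = n"
        unfolding DD_def by blast
      have "t ms i' \<le> t ns i'"
        by (rule D.nchain_greedy[OF chain[OF ms(1)] opt[OF ms] chain[OF ns(1)] i(2)])
           (use ns i in \<open>auto simp: t_def\<close>)
      then show "tail_sum ms i \<le> n" using ns i by (simp add: t_def)
    qed
  qed
  have last: "ms ! d = (LEAST n. n \<in> p_power_sums p m \<and> [n = r] (mod (q - 1)))"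
    if ms: "ms \<in> DD" "weight ms = Min (weight ` DD)" and special: "q = p \<or> d = 1 \<or> r = 0" for ms
  proof (rule Least_equality[symmetric], intro conjI)
    have k1: "k = 1 \<or> d = 1 \<or> r = 0"
      using special q p2 power_inject_exp[of p k 1] by auto
    have tl: "t ms (d - 1) = ms ! d"
      using tail_sum_Suc[of d ms] len[OF ms(1)] d by (simp add: t_def tail_sum_beyond)
    have nc: "D.nchain d (t ms)" by (rule chain[OF ms(1)])
    show "ms ! d \<in> p_power_sums p m"
      using D.nchain_submask[OF nc, of "d - 1"] d tl by (simp add: p_power_sums_eq[OF p2])
    show "[ms ! d = r] (mod (q - 1))"
      using nc d unfolding tl[symmetric] D.nchain_def q by auto
    fix n assume "n \<in> p_power_sums p m \<and> [n = r] (mod (q - 1))"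
    then have "t ms (d - 1) \<le> n"
      by (intro D.nchain_last_least[OF nc d opt[OF ms] k1]) (auto simp: p_power_sums_eq[OF p2] q)
    then show "ms ! d \<le> n" by (simp only: tl)
  qed
  show ?thesis using empty nonempty greedy last unfolding DD_def by blast
qed

end
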